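(* Let $K$ be a field of characteristic zero and let $R$ be one of the following rings: (i) the polynomial ring $R = K[X_1,\ldots,X_n]$; (ii) the formal power series ring $R = K[[X_1,\ldots,X_n]]$; (iii) the ring of convergent power series $R = \mathbb{C}\{z_1,\ldots,z_n\}$ with complex coefficients, in which case $K = \mathbb{C}$. Let $D$ be the ring of $K$-linear differential operators on $R$, and let $E$ be an injective left $D$-module. Then $E$, regarded as an $R$-module by restriction of scalars along $R \subseteq D$, is an injective $R$-module.
   Context: The ring $R$ is regarded as a subring of $D \subseteq \operatorname{End}_K(R)$ by letting elements of $R$ act by multiplication. In each of the three cases $D = R[\partial_1,\ldots,\partial_n]$, the subring of $\operatorname{End}_K(R)$ generated by $R$ and the partial derivatives $\partial_i$ with respect to the $i$-th variable; in case (i) this is the $n$-th Weyl algebra $A_n(K)$. *)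

theory Defs
  imports
    "HOL-Algebra.Algebraic_Closure_Type"
    "HOL-Algebra.Module"
    "HOL-Analysis.Infinite_Sum"
    "HOL-Library.Poly_Mapping"
begin

section \<open>Left modules and injectivity\<close>

text \<open>The library's \<open>module\<close> requires a commutative ring of scalars. Only the fields
  \<open>carrier\<close>, \<open>add\<close>, \<open>zero\<close> and \<open>smult\<close> of the module record are meaningful.\<close>

locale left_module = R?: ring R + M?: abelian_group M
  for R :: "('a, 'x) ring_scheme" (structure) and M :: "('a, 'm, 'y) module_scheme" (structure) +
  assumes smult_closed:
      "\<lbrakk>a \<in> carrier R; x \<in> carrier M\<rbrakk> \<Longrightarrow> a \<odot>\<^bsub>M\<^esub> x \<in> carrier M"
    and smult_l_distr:
      "\<lbrakk>a \<in> carrier R; b \<in> carrier R; x \<in> carrier M\<rbrakk> \<Longrightarrow>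
        (a \<oplus>\<^bsub>R\<^esub> b) \<odot>\<^bsub>M\<^esub> x = a \<odot>\<^bsub>M\<^esub> x \<oplus>\<^bsub>M\<^esub> b \<odot>\<^bsub>M\<^esub> x"
    and smult_r_distr:
      "\<lbrakk>a \<in> carrier R; x \<in> carrier M; y \<in> carrier M\<rbrakk> \<Longrightarrow>
        a \<odot>\<^bsub>M\<^esub> (x \<oplus>\<^bsub>M\<^esub> y) = a \<odot>\<^bsub>M\<^esub> x \<oplus>\<^bsub>M\<^esub> a \<odot>\<^bsub>M\<^esub> y"
    and smult_assoc1:
      "\<lbrakk>a \<in> carrier R; b \<in> carrier R; x \<in> carrier M\<rbrakk> \<Longrightarrow>
        (a \<otimes>\<^bsub>R\<^esub> b) \<odot>\<^bsub>M\<^esub> x = a \<odot>\<^bsub>M\<^esub> (b \<odot>\<^bsub>M\<^esub> x)"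
    and smult_one:
      "x \<in> carrier M \<Longrightarrow> \<one>\<^bsub>R\<^esub> \<odot>\<^bsub>M\<^esub> x = x"

definition module_hom ::
    "('a, 'x) ring_scheme \<Rightarrow> ('a, 'm, 'y) module_scheme \<Rightarrow> ('a, 'p, 'z) module_scheme \<Rightarrow> ('m \<Rightarrow> 'p) set"
  where "module_hom R M N = {f \<in> carrier M \<rightarrow> carrier N.
    (\<forall>x\<in>carrier M. \<forall>y\<in>carrier M. f (x \<oplus>\<^bsub>M\<^esub> y) = f x \<oplus>\<^bsub>N\<^esub> f y) \<and>
    (\<forall>a\<in>carrier R. \<forall>x\<in>carrier M. f (a \<odot>\<^bsub>M\<^esub> x) = a \<odot>\<^bsub>N\<^esub> f x)}"

text \<open>HOL cannot quantify over types inside a formula, so injectivity is relative to the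
  type \<open>'m\<close> that hosts the test modules \<open>M\<close> and \<open>N\<close>; the module \<open>E\<close> may live in any type.
  By Baer's criterion, injectivity relative to the type of the elements of \<open>R\<close>
  (or any type at least as large) is injectivity relative to every type.\<close>

definition injective_module ::
    "'m itself \<Rightarrow> ('a, 'x) ring_scheme \<Rightarrow> ('a, 'e, 'y) module_scheme \<Rightarrow> bool"
  where "injective_module _ R E \<longleftrightarrow> left_module R E \<and>
    (\<forall>(M :: ('a, 'm) module) (N :: ('a, 'm) module) f g.
      left_module R M \<and> left_module R N \<and>
      f \<in> module_hom R M N \<and> inj_on f (carrier M) \<and> g \<in> module_hom R M E \<longrightarrow>
      (\<exists>h \<in> module_hom R N E. \<forall>x\<in>carrier M. h (f x) = g x))"

definition restrict_scalars ::
    "('a \<Rightarrow> 'b) \<Rightarrow> ('b, 'e) module \<Rightarrow> ('a, 'e) module"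
  where "restrict_scalars \<phi> E = \<lparr>carrier = carrier E, monoid.mult = monoid.mult E, one = one E,
    zero = zero E, add = add E, module.smult = (\<lambda>a x. \<phi> a \<odot>\<^bsub>E\<^esub> x)\<rparr>"


section \<open>Differential operators on a commutative algebra\<close>

text \<open>Operators are extensional functions (\<open>undefined\<close> outside the carrier), so that equality
  of operators is equality of maps on the carrier.\<close>

definition linear_endos ::
    "('k, 'x) ring_scheme \<Rightarrow> ('k, 'r, 'y) module_scheme \<Rightarrow> ('r \<Rightarrow> 'r) set"
  where "linear_endos K A = {P \<in> carrier A \<rightarrow>\<^sub>E carrier A.
    (\<forall>f\<in>carrier A. \<forall>g\<in>carrier A. P (f \<oplus>\<^bsub>A\<^esub> g) = P f \<oplus>\<^bsub>A\<^esub> P g) \<and>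
    (\<forall>c\<in>carrier K. \<forall>f\<in>carrier A. P (c \<odot>\<^bsub>A\<^esub> f) = c \<odot>\<^bsub>A\<^esub> P f)}"

definition mult_op :: "('r, 'y) ring_scheme \<Rightarrow> 'r \<Rightarrow> 'r \<Rightarrow> 'r"
  where "mult_op A r = (\<lambda>f\<in>carrier A. r \<otimes>\<^bsub>A\<^esub> f)"

text \<open>The commutator of \<open>P\<close> with multiplication by \<open>r\<close>.\<close>

definition commutator_op :: "('r, 'y) ring_scheme \<Rightarrow> ('r \<Rightarrow> 'r) \<Rightarrow> 'r \<Rightarrow> 'r \<Rightarrow> 'r"
  where "commutator_op A P r = (\<lambda>f\<in>carrier A. P (r \<otimes>\<^bsub>A\<^esub> f) \<ominus>\<^bsub>A\<^esub> r \<otimes>\<^bsub>A\<^esub> P f)"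

text \<open>Grothendieck's filtration by order, with the operators of order \<open>0\<close> being the
  \<open>A\<close>-linear ones. For the three algebras below, over a field of characteristic zero, the
  union of the filtration is the subring of the endomorphism ring generated by the
  multiplication operators and the partial derivatives.\<close>

fun diff_ops_of_order ::
    "('k, 'x) ring_scheme \<Rightarrow> ('k, 'r, 'y) module_scheme \<Rightarrow> nat \<Rightarrow> ('r \<Rightarrow> 'r) set"
  where
    "diff_ops_of_order K A 0 = {P \<in> linear_endos K A.
      \<forall>r\<in>carrier A. commutator_op A P r = (\<lambda>f\<in>carrier A. \<zero>\<^bsub>A\<^esub>)}"
  | "diff_ops_of_order K A (Suc k) = {P \<in> linear_endos K A.
      \<forall>r\<in>carrier A. commutator_op A P r \<in> diff_ops_of_order K A k}"

definition diff_op_ring ::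
    "('k, 'x) ring_scheme \<Rightarrow> ('k, 'r, 'y) module_scheme \<Rightarrow> ('r \<Rightarrow> 'r) ring"
  where "diff_op_ring K A = \<lparr>
    carrier = (\<Union>k. diff_ops_of_order K A k),
    monoid.mult = (\<lambda>P Q. compose (carrier A) P Q),
    one = (\<lambda>f\<in>carrier A. f),
    zero = (\<lambda>f\<in>carrier A. \<zero>\<^bsub>A\<^esub>),
    add = (\<lambda>P Q. \<lambda>f\<in>carrier A. P f \<oplus>\<^bsub>A\<^esub> Q f)\<rparr>"


section \<open>Polynomials, formal and convergent power series in \<open>n\<close> variables\<close>

text \<open>Exponents are finitely supported functions \<open>nat \<Rightarrow>\<^sub>0 nat\<close>; the variables are those with
  index \<open>i < n\<close>.\<close>

type_synonym 'k mpoly = "(nat \<Rightarrow>\<^sub>0 nat) \<Rightarrow>\<^sub>0 'k"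
type_synonym 'k mseries = "(nat \<Rightarrow>\<^sub>0 nat) \<Rightarrow> 'k"

definition poly_algebra :: "nat \<Rightarrow> ('k::field, 'k mpoly) module"
  where "poly_algebra n = \<lparr>
    carrier = {p. \<forall>\<alpha>\<in>Poly_Mapping.keys p. Poly_Mapping.keys \<alpha> \<subseteq> {..<n}},
    monoid.mult = (*), one = 1, zero = 0, add = (+),
    module.smult = (\<lambda>c p. Poly_Mapping.single 0 c * p)\<rparr>"

definition series_algebra :: "nat \<Rightarrow> ('k::field, 'k mseries) module"
  where "series_algebra n = \<lparr>
    carrier = {f. \<forall>\<alpha>. f \<alpha> \<noteq> 0 \<longrightarrow> Poly_Mapping.keys \<alpha> \<subseteq> {..<n}},
    monoid.mult = (\<lambda>f g \<gamma>. \<Sum>(\<alpha>, \<beta>) | \<alpha> + \<beta> = \<gamma>. f \<alpha> * g \<beta>),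
    one = (\<lambda>\<alpha>. if \<alpha> = 0 then 1 else 0),
    zero = (\<lambda>\<alpha>. 0),
    add = (\<lambda>f g \<alpha>. f \<alpha> + g \<alpha>),
    module.smult = (\<lambda>c f \<alpha>. c * f \<alpha>)\<rparr>"

definition convergent_series :: "nat \<Rightarrow> complex mseries \<Rightarrow> bool"
  where "convergent_series n f \<longleftrightarrow>
    (\<exists>\<rho>>0. \<forall>z :: nat \<Rightarrow> complex. (\<forall>i<n. norm (z i) < \<rho>) \<longrightarrow>
      (\<lambda>\<alpha>. f \<alpha> * (\<Prod>i<n. z i ^ Poly_Mapping.lookup \<alpha> i))
        summable_on {\<alpha>. Poly_Mapping.keys \<alpha> \<subseteq> {..<n}})"

definition convergent_series_algebra :: "nat \<Rightarrow> (complex, complex mseries) module"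
  where "convergent_series_algebra n = (series_algebra n)
    \<lparr>carrier := {f \<in> carrier (series_algebra n). convergent_series n f}\<rparr>"

end

theory Submission
  imports Defs
begin

text \<open>By Baer's criterion it suffices to show that every \<open>R\<close>-linear map \<open>g : I \<rightarrow> E\<close> on an ideal \<open>I\<close>
  of \<open>R\<close> is \<open>a \<mapsto> a e\<close> for some \<open>e \<in> E\<close>. As \<open>D\<close> is free as a right \<open>R\<close>-module on the monomials in
  the \<open>\<partial>\<^sub>i\<close>, \<open>g\<close> extends to a \<open>D\<close>-linear map on the left ideal \<open>D I\<close>, and injectivity of \<open>E\<close> over
  \<open>D\<close> yields \<open>e\<close>. The freeness is obtained one variable at a time. Let \<open>S\<^sub>j\<close> be the centralizer of
  \<open>x\<^sub>0, \<dots>, x\<^bsub>j-1\<^esub>\<close> in \<open>D\<close>. The commutator with \<open>x\<^sub>j\<close> lowers the order of operators, hence is locally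
  nilpotent on \<open>S\<^sub>j\<close>, and \<open>[\<partial>\<^sub>j, x\<^sub>j] = 1\<close>; in characteristic zero, integrating and differentiating
  with respect to \<open>\<partial>\<^sub>j\<close> gives \<open>S\<^sub>j = \<Oplus>\<^sub>m \<partial>\<^sub>j\<^sup>m S\<^bsub>j+1\<^esub>\<close>. The chain starts at \<open>S\<^sub>0 = D\<close> and ends at
  \<open>S\<^sub>n = R\<close>.\<close>

section \<open>Baer's criterion for left modules\<close>

text \<open>On \<open>D I\<close>, the direct sum of the \<open>\<partial>\<^sup>m I\<close>, the
  extension of \<open>g\<close> sends the sum of the \<open>\<partial>\<^sup>m a\<^sub>m\<close> to
  the sum of the \<open>\<partial>\<^sup>m g(a\<^sub>m)\<close>. Uniqueness of the coefficients
  makes this well defined. Linearity over \<open>D\<close> is a separate matter: a scalar standing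
  to the left of a power of a derivative has to be moved to its right, and this works because
  commutators with the derivative lead back into the smaller ring. The obstacle is that
  \<open>diff_op_ring\<close> is given by the order filtration and not by generators, so the normal
  form has to be extracted from commutators. Treating one variable at a time turns this into
  calculus in a single element \<open>d\<close> with \<open>[d, x] = 1\<close>. That
  \<open>S\<^sub>n = R\<close> is not formal either: commuting with the variables only gives
  linearity over polynomials. For power series one also uses that a series whose coefficients vanish
  in every degree is zero. All subrings of the chain are sets inside the one ring \<open>D\<close>,
  and partial linear maps are graphs, so that \<open>E\<close> and its scalar action never change
  during the descent.\<close>

definition regular_module :: "('a, 'x) ring_scheme \<Rightarrow> ('a, 'a) module"
  where "regular_module R = \<lparr>carrier = carrier R, monoid.mult = monoid.mult R, one = one R,
    zero = zero R, add = add R, module.smult = monoid.mult R\<rparr>"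

lemma regular_module_simps [simp]:
  "carrier (regular_module R) = carrier R"
  "\<zero>\<^bsub>regular_module R\<^esub> = \<zero>\<^bsub>R\<^esub>"
  "x \<oplus>\<^bsub>regular_module R\<^esub> y = x \<oplus>\<^bsub>R\<^esub> y"
  "a \<odot>\<^bsub>regular_module R\<^esub> x = a \<otimes>\<^bsub>R\<^esub> x"
  by (simp_all add: regular_module_def)

text \<open>A relation in place of a function with a domain: unions of chains and enlarged domains
  are then plain set operations. Single-valuedness is demanded at zero only; closure under sums and
  under the scalar -1 spreads it to all elements. The scalars range over a set \<open>T\<close>,
  which may be smaller than the ring over which \<open>N\<close> and \<open>E\<close> are
  modules.\<close>

definition linear_graph ::
    "'a set \<Rightarrow> ('a, 'm, 'y) module_scheme \<Rightarrow> ('a, 'e, 'z) module_scheme \<Rightarrow> ('m \<times> 'e) set \<Rightarrow> bool"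
  where "linear_graph T N E \<Gamma> \<longleftrightarrow>
    \<Gamma> \<subseteq> carrier N \<times> carrier E \<and> (\<zero>\<^bsub>N\<^esub>, \<zero>\<^bsub>E\<^esub>) \<in> \<Gamma> \<and>
    (\<forall>u y v z. (u, y) \<in> \<Gamma> \<longrightarrow> (v, z) \<in> \<Gamma> \<longrightarrow> (u \<oplus>\<^bsub>N\<^esub> v, y \<oplus>\<^bsub>E\<^esub> z) \<in> \<Gamma>) \<and>
    (\<forall>a\<in>T. \<forall>u y. (u, y) \<in> \<Gamma> \<longrightarrow> (a \<odot>\<^bsub>N\<^esub> u, a \<odot>\<^bsub>E\<^esub> y) \<in> \<Gamma>) \<and>
    (\<forall>y. (\<zero>\<^bsub>N\<^esub>, y) \<in> \<Gamma> \<longrightarrow> y = \<zero>\<^bsub>E\<^esub>)"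

lemma linear_graphD:
  assumes "linear_graph T N E \<Gamma>"
  shows "(u, y) \<in> \<Gamma> \<Longrightarrow> u \<in> carrier N" "(u, y) \<in> \<Gamma> \<Longrightarrow> y \<in> carrier E"
    "(\<zero>\<^bsub>N\<^esub>, \<zero>\<^bsub>E\<^esub>) \<in> \<Gamma>"
    "(u, y) \<in> \<Gamma> \<Longrightarrow> (v, z) \<in> \<Gamma> \<Longrightarrow> (u \<oplus>\<^bsub>N\<^esub> v, y \<oplus>\<^bsub>E\<^esub> z) \<in> \<Gamma>"
    "a \<in> T \<Longrightarrow> (u, y) \<in> \<Gamma> \<Longrightarrow> (a \<odot>\<^bsub>N\<^esub> u, a \<odot>\<^bsub>E\<^esub> y) \<in> \<Gamma>"
    "(\<zero>\<^bsub>N\<^esub>, y) \<in> \<Gamma> \<Longrightarrow> y = \<zero>\<^bsub>E\<^esub>"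
  using assms unfolding linear_graph_def by blast+

text \<open>For a subring \<open>T\<close> of \<open>R\<close>: every linear map from a left ideal of \<open>T\<close> to \<open>E\<close>, encoded as
  its graph \<open>\<Gamma>\<close>, is \<open>a \<mapsto> a e\<close> for some \<open>e\<close>.\<close>

definition baer_on :: "'a set \<Rightarrow> ('a, 'x) ring_scheme \<Rightarrow> ('a, 'e, 'z) module_scheme \<Rightarrow> bool"
  where "baer_on T R E \<longleftrightarrow>
    (\<forall>\<Gamma>. linear_graph T (regular_module R) E \<Gamma> \<and> Domain \<Gamma> \<subseteq> T \<longrightarrow>
      (\<exists>e\<in>carrier E. \<forall>a y. (a, y) \<in> \<Gamma> \<longrightarrow> y = a \<odot>\<^bsub>E\<^esub> e))"

lemma baer_onE:
  assumes "baer_on T R E" "linear_graph T (regular_module R) E \<Gamma>" "Domain \<Gamma> \<subseteq> T"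
  obtains e where "e \<in> carrier E" "\<And>a y. (a, y) \<in> \<Gamma> \<Longrightarrow> y = a \<odot>\<^bsub>E\<^esub> e"
  using assms unfolding baer_on_def by meson

context left_module
begin

lemma smult_l_zero: "x \<in> carrier M \<Longrightarrow> \<zero>\<^bsub>R\<^esub> \<odot>\<^bsub>M\<^esub> x = \<zero>\<^bsub>M\<^esub>"
  by (metis M.add.l_cancel_one R.zero_closed R.l_zero smult_closed smult_l_distr)

lemma smult_r_zero: "a \<in> carrier R \<Longrightarrow> a \<odot>\<^bsub>M\<^esub> \<zero>\<^bsub>M\<^esub> = \<zero>\<^bsub>M\<^esub>"
  by (metis M.add.l_cancel_one M.zero_closed M.l_zero smult_closed smult_r_distr)

lemma smult_minus_one: "x \<in> carrier M \<Longrightarrow> (\<ominus>\<^bsub>R\<^esub> \<one>\<^bsub>R\<^esub>) \<odot>\<^bsub>M\<^esub> x = \<ominus>\<^bsub>M\<^esub> x"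
  using smult_l_distr[of "\<ominus>\<^bsub>R\<^esub> \<one>\<^bsub>R\<^esub>" "\<one>\<^bsub>R\<^esub>" x] smult_closed[of "\<ominus>\<^bsub>R\<^esub> \<one>\<^bsub>R\<^esub>" x]
  by (simp add: R.l_neg smult_l_zero smult_one M.minus_equality)

lemma linear_graph_minus:
  assumes G: "linear_graph (carrier R) M E \<Gamma>" and E: "left_module R E" and uy: "(u, y) \<in> \<Gamma>"
  shows "(\<ominus>\<^bsub>M\<^esub> u, \<ominus>\<^bsub>E\<^esub> y) \<in> \<Gamma>"
  using linear_graphD(5)[OF G _ uy, of "\<ominus>\<^bsub>R\<^esub> \<one>\<^bsub>R\<^esub>"] linear_graphD(1,2)[OF G uy]
    smult_minus_one left_module.smult_minus_one[OF E] by simp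

lemma linear_graph_unique:
  assumes G: "linear_graph (carrier R) M E \<Gamma>" and E: "left_module R E"
    and uy: "(u, y) \<in> \<Gamma>" and uz: "(u, z) \<in> \<Gamma>"
  shows "y = z"
proof -
  interpret E: left_module R E by (rule E)
  have "(u \<oplus>\<^bsub>M\<^esub> \<ominus>\<^bsub>M\<^esub> u, y \<oplus>\<^bsub>E\<^esub> \<ominus>\<^bsub>E\<^esub> z) \<in> \<Gamma>"
    by (rule linear_graphD(4)[OF G uy linear_graph_minus[OF G E uz]])
  then have "y \<oplus>\<^bsub>E\<^esub> \<ominus>\<^bsub>E\<^esub> z = \<zero>\<^bsub>E\<^esub>"
    using linear_graphD(6)[OF G] M.r_neg linear_graphD(1)[OF G uy] by metis
  then show ?thesis
    using linear_graphD(2)[OF G uy] linear_graphD(2)[OF G uz]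
    by (metis E.M.add.inv_closed E.M.minus_equality E.M.minus_minus)
qed

end

text \<open>\<open>Domain \<Gamma>\<close> is a left ideal. The map encoded by
  \<open>\<Gamma>\<close> extends along the inclusion of this ideal into the regular module, and
  \<open>e\<close> is the value of the extension at 1. Both test modules have elements of type
  \<open>'a\<close>, which fixes the type at which injectivity is used.\<close>

lemma injective_module_imp_baer_on:
  fixes R :: "('a, 'x) ring_scheme" and E :: "('a, 'e, 'z) module_scheme"
  assumes inj: "injective_module TYPE('a) R E"
  shows "baer_on (carrier R) R E"
  unfolding baer_on_def
proof (intro allI impI, elim conjE)
  fix \<Gamma> assume G: "linear_graph (carrier R) (regular_module R) E \<Gamma>"
  have E: "left_module R E" using inj by (simp add: injective_module_def)
  interpret E: left_module R E by (rule E)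
  have reg: "left_module R (regular_module R)"
    by unfold_locales
      (auto simp: E.R.add.m_ac E.R.m_assoc E.R.l_distr E.R.r_distr Units_def
        intro: E.R.l_neg E.R.r_neg)
  interpret N: left_module R "regular_module R" by (rule reg)
  define J where "J = (regular_module R)\<lparr>carrier := Domain \<Gamma>\<rparr>"
  have J_simps: "carrier J = Domain \<Gamma>" "\<zero>\<^bsub>J\<^esub> = \<zero>\<^bsub>R\<^esub>" "\<And>x y. x \<oplus>\<^bsub>J\<^esub> y = x \<oplus>\<^bsub>R\<^esub> y"
    "\<And>x y. x \<odot>\<^bsub>J\<^esub> y = x \<otimes>\<^bsub>R\<^esub> y"
    by (simp_all add: J_def regular_module_def)
  note GD = linear_graphD[OF G, simplified]
  have Jsub: "x \<in> Domain \<Gamma> \<Longrightarrow> x \<in> carrier R" for x using GD(1) by blast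
  have Jadd: "x \<in> Domain \<Gamma> \<Longrightarrow> y \<in> Domain \<Gamma> \<Longrightarrow> x \<oplus>\<^bsub>R\<^esub> y \<in> Domain \<Gamma>" for x y
    using GD(4) by blast
  have Jsm: "a \<in> carrier R \<Longrightarrow> y \<in> Domain \<Gamma> \<Longrightarrow> a \<otimes>\<^bsub>R\<^esub> y \<in> Domain \<Gamma>" for a y
    using GD(5) by blast
  have Jneg: "y \<in> Domain \<Gamma> \<Longrightarrow> \<ominus>\<^bsub>R\<^esub> y \<in> Domain \<Gamma>" for y
    using Jsm[of "\<ominus>\<^bsub>R\<^esub> \<one>\<^bsub>R\<^esub>" y] Jsub E.R.l_minus by fastforce
  have "abelian_group J"
  proof (rule abelian_groupI)
    fix x assume "x \<in> carrier J"
    then show "\<exists>y\<in>carrier J. y \<oplus>\<^bsub>J\<^esub> x = \<zero>\<^bsub>J\<^esub>"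
      using Jneg Jsub E.R.l_neg by (metis J_simps(1,2,3))
  qed (use Jadd Jsub GD(3) in \<open>auto simp del: Domain_iff simp: J_simps E.R.add.m_ac Domain.DomainI\<close>)
  then interpret J: abelian_group J .
  have lJ: "left_module R J"
    by unfold_locales
      (use Jadd Jsub Jsm in \<open>auto simp del: Domain_iff simp: J_simps E.R.m_assoc E.R.l_distr E.R.r_distr\<close>)
  define g where "g = (\<lambda>u. SOME y. (u, y) \<in> \<Gamma>)"
  have g: "u \<in> Domain \<Gamma> \<Longrightarrow> (u, g u) \<in> \<Gamma>" for u
    unfolding g_def by (rule someI_ex) blast
  have guniq: "(u, y) \<in> \<Gamma> \<Longrightarrow> g u = y" for u y
    using N.linear_graph_unique[OF G E] g by blast
  have ghom: "g \<in> module_hom R J E"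
    unfolding module_hom_def J_simps
    using GD(2)[OF g] guniq[OF GD(4)[OF g g]] guniq[OF GD(5)[OF _ g]] by blast
  have idhom: "(\<lambda>x. x) \<in> module_hom R J (regular_module R)"
    using Jsub by (auto simp: module_hom_def J_simps)
  obtain h where h: "h \<in> module_hom R (regular_module R) E" "\<forall>x\<in>carrier J. h x = g x"
    using inj lJ reg idhom ghom unfolding injective_module_def
    by (metis inj_on_id2)
  have "h \<one>\<^bsub>R\<^esub> \<in> carrier E" using h(1) by (auto simp: module_hom_def)
  moreover have "y = a \<odot>\<^bsub>E\<^esub> h \<one>\<^bsub>R\<^esub>" if "(a, y) \<in> \<Gamma>" for a y
  proof -
    have "a \<in> carrier R" using GD(1) that by blast
    then have "h (a \<otimes>\<^bsub>R\<^esub> \<one>\<^bsub>R\<^esub>) = a \<odot>\<^bsub>E\<^esub> h \<one>\<^bsub>R\<^esub>"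
      using h(1) E.R.one_closed unfolding module_hom_def regular_module_simps by blast
    then show ?thesis
      using h(2) that guniq[OF that] \<open>a \<in> carrier R\<close> by (metis Domain.DomainI E.R.r_one J_simps(1))
  qed
  ultimately show "\<exists>e\<in>carrier E. \<forall>a y. (a, y) \<in> \<Gamma> \<longrightarrow> y = a \<odot>\<^bsub>E\<^esub> e" by blast
qed

text \<open>The one-element step for Zorn's lemma: Baer's property, applied to the ideal of scalars
  that carry \<open>n\<close> into \<open>Domain \<Gamma>\<close>, selects a value \<open>e\<close>
  that may consistently be assigned to \<open>n\<close>.\<close>

lemma baer_on_imp_extension:
  assumes E: "left_module R E" and N: "left_module R N" and baer: "baer_on (carrier R) R E"
    and G: "linear_graph (carrier R) N E \<Gamma>" and n: "n \<in> carrier N"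
  shows "\<exists>\<Delta>. linear_graph (carrier R) N E \<Delta> \<and> \<Gamma> \<subseteq> \<Delta> \<and> n \<in> Domain \<Delta>"
proof -
  interpret E: left_module R E by (rule E)
  interpret N: left_module R N by (rule N)
  note GD = linear_graphD[OF G]
  \<comment> \<open>The map that \<open>\<Gamma>\<close> forces on the conductor ideal of
    \<open>n\<close>: \<open>a\<close> goes to the value of \<open>\<Gamma>\<close> at
    \<open>a n\<close>.\<close>
  define \<Phi> where "\<Phi> = {(a, y). a \<in> carrier R \<and> (a \<odot>\<^bsub>N\<^esub> n, y) \<in> \<Gamma>}"
  have "linear_graph (carrier R) (regular_module R) E \<Phi>"
    unfolding linear_graph_def
  proof (intro conjI allI impI ballI)
    show "\<Phi> \<subseteq> carrier (regular_module R) \<times> carrier E"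
      unfolding \<Phi>_def using GD(2) by auto
    show "(\<zero>\<^bsub>regular_module R\<^esub>, \<zero>\<^bsub>E\<^esub>) \<in> \<Phi>"
      unfolding \<Phi>_def using GD(3) n by (simp add: N.smult_l_zero)
  next
    fix a y b z assume "(a, y) \<in> \<Phi>" "(b, z) \<in> \<Phi>"
    then show "(a \<oplus>\<^bsub>regular_module R\<^esub> b, y \<oplus>\<^bsub>E\<^esub> z) \<in> \<Phi>"
      unfolding \<Phi>_def using GD(4)[of "a \<odot>\<^bsub>N\<^esub> n" y "b \<odot>\<^bsub>N\<^esub> n" z] n by (simp add: N.smult_l_distr)
  next
    fix a b y assume "a \<in> carrier R" "(b, y) \<in> \<Phi>"
    then show "(a \<odot>\<^bsub>regular_module R\<^esub> b, a \<odot>\<^bsub>E\<^esub> y) \<in> \<Phi>"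
      unfolding \<Phi>_def using GD(5)[of a "b \<odot>\<^bsub>N\<^esub> n" y] n by (simp add: N.smult_assoc1)
  next
    fix y assume "(\<zero>\<^bsub>regular_module R\<^esub>, y) \<in> \<Phi>"
    then show "y = \<zero>\<^bsub>E\<^esub>"
      unfolding \<Phi>_def using GD(6) n by (simp add: N.smult_l_zero)
  qed
  moreover have "Domain \<Phi> \<subseteq> carrier R" by (auto simp: \<Phi>_def)
  ultimately obtain e where e: "e \<in> carrier E"
      and e': "\<And>a y. (a, y) \<in> \<Phi> \<Longrightarrow> y = a \<odot>\<^bsub>E\<^esub> e"
    by (rule baer_onE[OF baer]) blast
  define \<Delta> where "\<Delta> = {(u \<oplus>\<^bsub>N\<^esub> a \<odot>\<^bsub>N\<^esub> n, y \<oplus>\<^bsub>E\<^esub> a \<odot>\<^bsub>E\<^esub> e) | u y a. (u, y) \<in> \<Gamma> \<and> a \<in> carrier R}"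
  have memI: "(u', y') \<in> \<Delta>" if "(u, y) \<in> \<Gamma>" "a \<in> carrier R"
    "u' = u \<oplus>\<^bsub>N\<^esub> a \<odot>\<^bsub>N\<^esub> n" "y' = y \<oplus>\<^bsub>E\<^esub> a \<odot>\<^bsub>E\<^esub> e" for u y a u' y'
    using that unfolding \<Delta>_def by blast
  have sub: "\<Gamma> \<subseteq> \<Delta>"
  proof
    fix p assume "p \<in> \<Gamma>"
    then obtain u y where p: "p = (u, y)" "(u, y) \<in> \<Gamma>" by (cases p) auto
    show "p \<in> \<Delta>" unfolding p(1)
      by (rule memI[OF p(2) E.R.zero_closed])
        (use GD(1,2)[OF p(2)] e n in \<open>simp_all add: N.smult_l_zero E.smult_l_zero\<close>)
  qed
  have "linear_graph (carrier R) N E \<Delta>"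
    unfolding linear_graph_def
  proof (intro conjI allI impI ballI)
    show "\<Delta> \<subseteq> carrier N \<times> carrier E"
      using GD(1,2) e n N.smult_closed E.smult_closed unfolding \<Delta>_def by blast
    show "(\<zero>\<^bsub>N\<^esub>, \<zero>\<^bsub>E\<^esub>) \<in> \<Delta>" using GD(3) sub by blast
  next
    fix u y v z assume "(u, y) \<in> \<Delta>" "(v, z) \<in> \<Delta>"
    then obtain u' y' a v' z' b where *: "(u', y') \<in> \<Gamma>" "a \<in> carrier R" "(v', z') \<in> \<Gamma>" "b \<in> carrier R"
      "u = u' \<oplus>\<^bsub>N\<^esub> a \<odot>\<^bsub>N\<^esub> n" "y = y' \<oplus>\<^bsub>E\<^esub> a \<odot>\<^bsub>E\<^esub> e"
      "v = v' \<oplus>\<^bsub>N\<^esub> b \<odot>\<^bsub>N\<^esub> n" "z = z' \<oplus>\<^bsub>E\<^esub> b \<odot>\<^bsub>E\<^esub> e"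
      unfolding \<Delta>_def by blast
    show "(u \<oplus>\<^bsub>N\<^esub> v, y \<oplus>\<^bsub>E\<^esub> z) \<in> \<Delta>"
      by (rule memI[OF GD(4)[OF *(1,3)] E.R.a_closed[OF *(2,4)]])
        (use * GD(1,2)[OF *(1)] GD(1,2)[OF *(3)] e n in
          \<open>simp_all add: N.smult_l_distr E.smult_l_distr N.smult_closed E.smult_closed
             N.M.add.m_ac E.M.add.m_ac\<close>)
  next
    fix r u y assume r: "r \<in> carrier R" and "(u, y) \<in> \<Delta>"
    then obtain u' y' a where *: "(u', y') \<in> \<Gamma>" "a \<in> carrier R"
      "u = u' \<oplus>\<^bsub>N\<^esub> a \<odot>\<^bsub>N\<^esub> n" "y = y' \<oplus>\<^bsub>E\<^esub> a \<odot>\<^bsub>E\<^esub> e"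
      unfolding \<Delta>_def by blast
    show "(r \<odot>\<^bsub>N\<^esub> u, r \<odot>\<^bsub>E\<^esub> y) \<in> \<Delta>"
      by (rule memI[OF GD(5)[OF r *(1)] E.R.m_closed[OF r *(2)]])
        (use * r GD(1,2)[OF *(1)] e n in
          \<open>simp_all add: N.smult_r_distr E.smult_r_distr N.smult_closed E.smult_closed
             N.smult_assoc1 E.smult_assoc1\<close>)
  next
    fix y assume "(\<zero>\<^bsub>N\<^esub>, y) \<in> \<Delta>"
    then obtain u' y' a where *: "(u', y') \<in> \<Gamma>" "a \<in> carrier R"
      "\<zero>\<^bsub>N\<^esub> = u' \<oplus>\<^bsub>N\<^esub> a \<odot>\<^bsub>N\<^esub> n" "y = y' \<oplus>\<^bsub>E\<^esub> a \<odot>\<^bsub>E\<^esub> e"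
      unfolding \<Delta>_def by blast
    have u': "u' \<in> carrier N" and y': "y' \<in> carrier E" using GD(1,2)[OF *(1)] .
    \<comment> \<open>A relation \<open>u' + a n = 0\<close> puts \<open>a\<close> into the
      conductor ideal, so the choice of \<open>e\<close> fixes \<open>a e\<close> as the negative of
      \<open>y'\<close>. This makes \<open>\<Delta>\<close> single-valued.\<close>
    have "a \<odot>\<^bsub>N\<^esub> n = \<ominus>\<^bsub>N\<^esub> u'"
      using *(2,3) u' n by (metis N.M.a_comm N.M.minus_equality N.smult_closed)
    then have "(a, \<ominus>\<^bsub>E\<^esub> y') \<in> \<Phi>"
      using N.linear_graph_minus[OF G E *(1)] *(2) by (simp add: \<Phi>_def)
    then have "a \<odot>\<^bsub>E\<^esub> e = \<ominus>\<^bsub>E\<^esub> y'" using e' by metis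
    then show "y = \<zero>\<^bsub>E\<^esub>" using *(4) y' by (simp add: E.M.r_neg)
  qed
  moreover have "n \<in> Domain \<Delta>"
    using memI[OF GD(3) E.R.one_closed refl refl] n e
    by (metis DomainI N.smult_closed N.smult_one N.M.l_zero E.R.one_closed)
  ultimately show ?thesis using sub by blast
qed

text \<open>Zorn's lemma on the graphs that contain the graph of \<open>g\<close> transported along
  \<open>f\<close>. The argument takes place inside \<open>N\<close> and \<open>E\<close>, so the
  type \<open>'m\<close> of the test modules is arbitrary.\<close>

lemma baer_on_imp_injective_module:
  fixes R :: "('a, 'x) ring_scheme" and E :: "('a, 'e, 'z) module_scheme"
  assumes E: "left_module R E" and baer: "baer_on (carrier R) R E"
  shows "injective_module TYPE('m) R E"
  unfolding injective_module_def
proof (intro conjI allI impI E, elim conjE)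
  fix M N :: "('a, 'm) module" and f g
  assume M: "left_module R M" and N: "left_module R N"
    and f: "f \<in> module_hom R M N" "inj_on f (carrier M)" and g: "g \<in> module_hom R M E"
  interpret E: left_module R E by (rule E)
  interpret M: left_module R M by (rule M)
  interpret N: left_module R N by (rule N)
  define \<Gamma> where "\<Gamma> = (\<lambda>x. (f x, g x)) ` carrier M"
  have fc: "x \<in> carrier M \<Longrightarrow> f x \<in> carrier N" and gc: "x \<in> carrier M \<Longrightarrow> g x \<in> carrier E"
    and fa: "x \<in> carrier M \<Longrightarrow> y \<in> carrier M \<Longrightarrow> f (x \<oplus>\<^bsub>M\<^esub> y) = f x \<oplus>\<^bsub>N\<^esub> f y"
    and ga: "x \<in> carrier M \<Longrightarrow> y \<in> carrier M \<Longrightarrow> g (x \<oplus>\<^bsub>M\<^esub> y) = g x \<oplus>\<^bsub>E\<^esub> g y"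
    and fs: "a \<in> carrier R \<Longrightarrow> x \<in> carrier M \<Longrightarrow> f (a \<odot>\<^bsub>M\<^esub> x) = a \<odot>\<^bsub>N\<^esub> f x"
    and gs: "a \<in> carrier R \<Longrightarrow> x \<in> carrier M \<Longrightarrow> g (a \<odot>\<^bsub>M\<^esub> x) = a \<odot>\<^bsub>E\<^esub> g x" for a x y
    using f(1) g by (auto simp: module_hom_def)
  have f0: "f \<zero>\<^bsub>M\<^esub> = \<zero>\<^bsub>N\<^esub>"
    by (metis M.smult_l_zero N.smult_l_zero E.R.zero_closed M.M.zero_closed fc fs)
  have g0: "g \<zero>\<^bsub>M\<^esub> = \<zero>\<^bsub>E\<^esub>"
    by (metis M.smult_l_zero E.smult_l_zero E.R.zero_closed M.M.zero_closed gc gs)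
  have G: "linear_graph (carrier R) N E \<Gamma>"
    unfolding linear_graph_def
  proof (intro conjI allI impI ballI)
    show "\<Gamma> \<subseteq> carrier N \<times> carrier E" using fc gc by (auto simp: \<Gamma>_def)
    show "(\<zero>\<^bsub>N\<^esub>, \<zero>\<^bsub>E\<^esub>) \<in> \<Gamma>" unfolding \<Gamma>_def
      by (rule image_eqI[OF _ M.M.zero_closed]) (simp add: f0 g0)
  next
    fix u y v z assume "(u, y) \<in> \<Gamma>" "(v, z) \<in> \<Gamma>"
    then obtain x x' where "x \<in> carrier M" "x' \<in> carrier M" "u = f x" "y = g x" "v = f x'" "z = g x'"
      unfolding \<Gamma>_def by blast
    then show "(u \<oplus>\<^bsub>N\<^esub> v, y \<oplus>\<^bsub>E\<^esub> z) \<in> \<Gamma>"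
      unfolding \<Gamma>_def by (intro image_eqI[OF _ M.M.a_closed[of x x']]) (simp_all add: fa ga)
  next
    fix a u y assume a: "a \<in> carrier R" and "(u, y) \<in> \<Gamma>"
    then obtain x where "x \<in> carrier M" "u = f x" "y = g x"
      unfolding \<Gamma>_def by blast
    then show "(a \<odot>\<^bsub>N\<^esub> u, a \<odot>\<^bsub>E\<^esub> y) \<in> \<Gamma>"
      unfolding \<Gamma>_def by (intro image_eqI[OF _ M.smult_closed[OF a, of x]]) (simp_all add: fs gs a)
  next
    fix y assume "(\<zero>\<^bsub>N\<^esub>, y) \<in> \<Gamma>"
    then obtain x where x: "x \<in> carrier M" "f x = f \<zero>\<^bsub>M\<^esub>" "y = g x"
      unfolding \<Gamma>_def f0 by auto
    then show "y = \<zero>\<^bsub>E\<^esub>"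
      using inj_onD[OF f(2) x(2,1) M.M.zero_closed] g0 by simp
  qed
  define \<A> where "\<A> = {\<Delta>. linear_graph (carrier R) N E \<Delta> \<and> \<Gamma> \<subseteq> \<Delta>}"
  have "\<exists>\<Delta>\<in>\<A>. \<forall>Y\<in>\<A>. \<Delta> \<subseteq> Y \<longrightarrow> Y = \<Delta>"
  proof (rule subset_Zorn_nonempty)
    show "\<A> \<noteq> {}" using G by (auto simp: \<A>_def)
    fix \<C> assume ne: "\<C> \<noteq> {}" and ch: "subset.chain \<A> \<C>"
    then have C: "\<And>Y. Y \<in> \<C> \<Longrightarrow> linear_graph (carrier R) N E Y" "\<And>Y. Y \<in> \<C> \<Longrightarrow> \<Gamma> \<subseteq> Y"
      by (auto simp: subset_chain_def \<A>_def)
    have two: "\<exists>Y\<in>\<C>. p \<in> Y \<and> q \<in> Y" if "p \<in> \<Union>\<C>" "q \<in> \<Union>\<C>" for p q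
      using that ch unfolding subset_chain_def by blast
    have "linear_graph (carrier R) N E (\<Union>\<C>)"
      unfolding linear_graph_def
    proof (intro conjI allI impI ballI)
      show "\<Union>\<C> \<subseteq> carrier N \<times> carrier E" using C(1) unfolding linear_graph_def by blast
      show "(\<zero>\<^bsub>N\<^esub>, \<zero>\<^bsub>E\<^esub>) \<in> \<Union>\<C>" using C(1) ne linear_graphD(3) by blast
    next
      fix u y v z assume "(u, y) \<in> \<Union>\<C>" "(v, z) \<in> \<Union>\<C>"
      then obtain Y where "Y \<in> \<C>" "(u, y) \<in> Y" "(v, z) \<in> Y" using two by blast
      then show "(u \<oplus>\<^bsub>N\<^esub> v, y \<oplus>\<^bsub>E\<^esub> z) \<in> \<Union>\<C>" using linear_graphD(4)[OF C(1)] by blast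
    next
      fix a u y assume "a \<in> carrier R" "(u, y) \<in> \<Union>\<C>"
      then show "(a \<odot>\<^bsub>N\<^esub> u, a \<odot>\<^bsub>E\<^esub> y) \<in> \<Union>\<C>" using linear_graphD(5)[OF C(1)] by blast
    next
      fix y assume "(\<zero>\<^bsub>N\<^esub>, y) \<in> \<Union>\<C>"
      then show "y = \<zero>\<^bsub>E\<^esub>" using linear_graphD(6)[OF C(1)] by blast
    qed
    then show "\<Union>\<C> \<in> \<A>" using C(2) ne by (auto simp: \<A>_def)
  qed
  then obtain \<Delta> where D: "linear_graph (carrier R) N E \<Delta>" "\<Gamma> \<subseteq> \<Delta>"
      and max: "\<And>Y. Y \<in> \<A> \<Longrightarrow> \<Delta> \<subseteq> Y \<Longrightarrow> Y = \<Delta>"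
    by (auto simp: \<A>_def)
  \<comment> \<open>A maximal graph that missed \<open>u\<close> could be enlarged by the
    one-element step.\<close>
  have total: "u \<in> Domain \<Delta>" if u: "u \<in> carrier N" for u
    using baer_on_imp_extension[OF E N baer D(1) u] D(2) max unfolding \<A>_def by blast
  define h where "h = (\<lambda>u. SOME y. (u, y) \<in> \<Delta>)"
  have h: "u \<in> carrier N \<Longrightarrow> (u, h u) \<in> \<Delta>" for u
    unfolding h_def by (rule someI_ex) (use total in blast)
  have huniq: "(u, y) \<in> \<Delta> \<Longrightarrow> h u = y" for u y
    using N.linear_graph_unique[OF D(1) E] h linear_graphD(1)[OF D(1)] by blast
  note DD = linear_graphD[OF D(1)]
  have "h \<in> module_hom R N E"
    unfolding module_hom_def
    using DD(2)[OF h] huniq[OF DD(4)[OF h h]] huniq[OF DD(5)[OF _ h]] by blast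
  moreover have "\<forall>x\<in>carrier M. h (f x) = g x"
    using D(2) huniq by (auto simp: \<Gamma>_def)
  ultimately show "\<exists>h\<in>module_hom R N E. \<forall>x\<in>carrier M. h (f x) = g x" by blast
qed

section \<open>Restriction to the centralizer of one variable\<close>

text \<open>One link of the chain in abstract form. The sets \<open>F N\<close> serve to express
  that the commutator with \<open>x\<close> is locally nilpotent on \<open>S\<close>; they need not
  lie in \<open>S\<close>, hence the separate premise \<open>P \<in> S\<close>. The element
  \<open>q\<close> in \<open>char_0\<close> is \<open>1/(N+1)\<close>, available in \<open>S\<close>
  and commuting with \<open>x\<close>.\<close>

locale weyl_step = left_module D E
  for D :: "('a, 'x) ring_scheme" and E :: "('a, 'e, 'y) module_scheme" +
  fixes S :: "'a set" and d x :: 'a and F :: "nat \<Rightarrow> 'a set"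
  assumes S: "subring S D" and d: "d \<in> S" and x: "x \<in> S"
    and canonical: "d \<otimes>\<^bsub>D\<^esub> x = x \<otimes>\<^bsub>D\<^esub> d \<oplus>\<^bsub>D\<^esub> \<one>\<^bsub>D\<^esub>"
    and exhaust: "P \<in> S \<Longrightarrow> \<exists>N. P \<in> F N"
    and F_0: "P \<in> S \<Longrightarrow> P \<in> F 0 \<Longrightarrow> P \<otimes>\<^bsub>D\<^esub> x = x \<otimes>\<^bsub>D\<^esub> P"
    and F_Suc: "P \<in> S \<Longrightarrow> P \<in> F (Suc N) \<Longrightarrow> P \<otimes>\<^bsub>D\<^esub> x \<ominus>\<^bsub>D\<^esub> x \<otimes>\<^bsub>D\<^esub> P \<in> F N"
    and char_0: "\<exists>q\<in>S. q \<otimes>\<^bsub>D\<^esub> x = x \<otimes>\<^bsub>D\<^esub> q \<and> [Suc N] \<cdot>\<^bsub>D\<^esub> q = \<one>\<^bsub>D\<^esub>"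
begin

definition T :: "'a set" where "T = {s \<in> S. s \<otimes>\<^bsub>D\<^esub> x = x \<otimes>\<^bsub>D\<^esub> s}"

text \<open>The sign is the one for which \<open>d\<close> is sent to 1, so that \<open>ad\<close>
  acts as the derivative with respect to \<open>d\<close> with constants \<open>T\<close>.\<close>

definition ad :: "'a \<Rightarrow> 'a" where "ad P = P \<otimes>\<^bsub>D\<^esub> x \<ominus>\<^bsub>D\<^esub> x \<otimes>\<^bsub>D\<^esub> P"

lemma S_carrier: "s \<in> S \<Longrightarrow> s \<in> carrier D"
  using subringE(1)[OF S] by blast

lemmas dx_carrier [simp] = S_carrier[OF d] S_carrier[OF x]
lemmas S_closed = subringE(2,3,5,6,7)[OF S]

lemma T_S: "t \<in> T \<Longrightarrow> t \<in> S" and T_carrier: "t \<in> T \<Longrightarrow> t \<in> carrier D"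
  and T_commute: "t \<in> T \<Longrightarrow> t \<otimes>\<^bsub>D\<^esub> x = x \<otimes>\<^bsub>D\<^esub> t"
  by (auto simp: T_def S_carrier)

lemma subring_T: "subring T D"
proof (rule R.subringI)
  show "T \<subseteq> carrier D" using T_carrier by blast
  show "\<one>\<^bsub>D\<^esub> \<in> T" using S_closed by (simp add: T_def)
  show "\<ominus>\<^bsub>D\<^esub> h \<in> T" if "h \<in> T" for h
    using that S_closed T_carrier[OF that] by (simp add: T_def R.l_minus R.r_minus)
  show "h \<otimes>\<^bsub>D\<^esub> k \<in> T" if "h \<in> T" "k \<in> T" for h k
  proof -
    have "(h \<otimes>\<^bsub>D\<^esub> k) \<otimes>\<^bsub>D\<^esub> x = h \<otimes>\<^bsub>D\<^esub> (x \<otimes>\<^bsub>D\<^esub> k)"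
      using that by (simp add: T_carrier R.m_assoc T_commute)
    also have "\<dots> = x \<otimes>\<^bsub>D\<^esub> (h \<otimes>\<^bsub>D\<^esub> k)"
      using that by (simp add: T_carrier T_commute flip: R.m_assoc)
    finally show ?thesis using that S_closed by (simp add: T_def)
  qed
  show "h \<oplus>\<^bsub>D\<^esub> k \<in> T" if "h \<in> T" "k \<in> T" for h k
    using that S_closed T_carrier[OF that(1)] T_carrier[OF that(2)]
    by (simp add: T_def R.l_distr R.r_distr)
qed

lemmas T_closed = subringE(2,3,5,6,7)[OF subring_T]

lemma pow_closed: "d [^]\<^bsub>D\<^esub> (N::nat) \<in> S"
  by (induction N) (auto simp: S_closed d)

lemmas pow_carrier [simp] = S_carrier[OF pow_closed]

lemma add_pow_closed: "t \<in> T \<Longrightarrow> [(k::nat)] \<cdot>\<^bsub>D\<^esub> t \<in> T"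
  by (induction k) (auto simp: T_closed T_carrier)

lemma pow_x:
  "d [^]\<^bsub>D\<^esub> Suc N \<otimes>\<^bsub>D\<^esub> x = x \<otimes>\<^bsub>D\<^esub> d [^]\<^bsub>D\<^esub> Suc N \<oplus>\<^bsub>D\<^esub> [Suc N] \<cdot>\<^bsub>D\<^esub> (d [^]\<^bsub>D\<^esub> N)"
proof (induction N)
  case 0
  then show ?case by (simp add: canonical)
next
  case (Suc N)
  let ?p = "\<lambda>N. d [^]\<^bsub>D\<^esub> (N::nat)"
  have "?p (Suc (Suc N)) \<otimes>\<^bsub>D\<^esub> x = ?p (Suc N) \<otimes>\<^bsub>D\<^esub> (x \<otimes>\<^bsub>D\<^esub> d \<oplus>\<^bsub>D\<^esub> \<one>\<^bsub>D\<^esub>)"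
    by (subst R.nat_pow_Suc) (simp add: R.m_assoc canonical del: R.nat_pow_Suc)
  also have "\<dots> = (?p (Suc N) \<otimes>\<^bsub>D\<^esub> x) \<otimes>\<^bsub>D\<^esub> d \<oplus>\<^bsub>D\<^esub> ?p (Suc N)"
    by (simp add: R.r_distr R.m_assoc del: R.nat_pow_Suc)
  also have "\<dots> = x \<otimes>\<^bsub>D\<^esub> ?p (Suc (Suc N)) \<oplus>\<^bsub>D\<^esub> ([Suc N] \<cdot>\<^bsub>D\<^esub> ?p (Suc N) \<oplus>\<^bsub>D\<^esub> ?p (Suc N))"
    unfolding Suc
    by (simp add: R.l_distr R.m_assoc R.add_pow_ldistr R.a_assoc)
  finally show ?case
    by simp
qed

lemma ad_add: "P \<in> S \<Longrightarrow> Q \<in> S \<Longrightarrow> ad (P \<oplus>\<^bsub>D\<^esub> Q) = ad P \<oplus>\<^bsub>D\<^esub> ad Q"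
  by (simp add: ad_def S_carrier R.l_distr R.r_distr R.minus_eq R.minus_add R.add.m_ac)

lemma ad_closed: "P \<in> S \<Longrightarrow> ad P \<in> S"
  by (simp add: ad_def R.minus_eq S_closed x)

lemma ad_T: "t \<in> T \<Longrightarrow> ad t = \<zero>\<^bsub>D\<^esub>"
  by (simp add: ad_def T_commute T_carrier R.minus_eq R.r_neg)

lemma ad_eq_0: "P \<in> S \<Longrightarrow> ad P = \<zero>\<^bsub>D\<^esub> \<Longrightarrow> P \<in> T"
  by (simp add: T_def ad_def S_carrier)

text \<open>The power rule: \<open>t\<close> commutes with \<open>x\<close>, so only the power of
  \<open>d\<close> is differentiated, and the integer factor is moved onto \<open>t\<close>.\<close>

lemma ad_pow:
  assumes t: "t \<in> T"
  shows "ad (d [^]\<^bsub>D\<^esub> Suc N \<otimes>\<^bsub>D\<^esub> t) = d [^]\<^bsub>D\<^esub> N \<otimes>\<^bsub>D\<^esub> [Suc N] \<cdot>\<^bsub>D\<^esub> t"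
proof -
  let ?p = "\<lambda>N. d [^]\<^bsub>D\<^esub> (N::nat)"
  have "(?p (Suc N) \<otimes>\<^bsub>D\<^esub> t) \<otimes>\<^bsub>D\<^esub> x = (?p (Suc N) \<otimes>\<^bsub>D\<^esub> x) \<otimes>\<^bsub>D\<^esub> t"
    using t by (simp add: T_carrier R.m_assoc T_commute del: R.nat_pow_Suc)
  also have "\<dots> = ?p N \<otimes>\<^bsub>D\<^esub> [Suc N] \<cdot>\<^bsub>D\<^esub> t \<oplus>\<^bsub>D\<^esub> x \<otimes>\<^bsub>D\<^esub> (?p (Suc N) \<otimes>\<^bsub>D\<^esub> t)"
    unfolding pow_x using T_carrier[OF t]
    by (simp add: R.l_distr R.m_assoc R.add_pow_ldistr R.add_pow_rdistr R.a_comm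
        del: R.nat_pow_Suc R.add.nat_pow_Suc)
  finally show ?thesis
    using T_carrier[OF t]
    by (simp add: ad_def R.minus_eq R.a_assoc R.r_neg del: R.nat_pow_Suc R.add.nat_pow_Suc)
qed

text \<open>Both \<open>d s\<close> and \<open>s d\<close> have derivative \<open>s\<close>, so
  their difference is a constant. This is what later allows an element of \<open>T\<close> to be
  moved past powers of \<open>d\<close>.\<close>

lemma commutator_T:
  assumes s: "s \<in> T"
  shows "d \<otimes>\<^bsub>D\<^esub> s \<ominus>\<^bsub>D\<^esub> s \<otimes>\<^bsub>D\<^esub> d \<in> T"
proof -
  have sc [simp]: "s \<in> carrier D" using s by (rule T_carrier)
  have 1: "(d \<otimes>\<^bsub>D\<^esub> s) \<otimes>\<^bsub>D\<^esub> x = x \<otimes>\<^bsub>D\<^esub> (d \<otimes>\<^bsub>D\<^esub> s) \<oplus>\<^bsub>D\<^esub> s"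
  proof -
    have "(d \<otimes>\<^bsub>D\<^esub> s) \<otimes>\<^bsub>D\<^esub> x = (d \<otimes>\<^bsub>D\<^esub> x) \<otimes>\<^bsub>D\<^esub> s"
      using s by (simp add: R.m_assoc T_commute)
    then show ?thesis by (simp add: canonical R.l_distr R.m_assoc)
  qed
  have 2: "(s \<otimes>\<^bsub>D\<^esub> d) \<otimes>\<^bsub>D\<^esub> x = x \<otimes>\<^bsub>D\<^esub> (s \<otimes>\<^bsub>D\<^esub> d) \<oplus>\<^bsub>D\<^esub> s"
  proof -
    have "(s \<otimes>\<^bsub>D\<^esub> d) \<otimes>\<^bsub>D\<^esub> x = (s \<otimes>\<^bsub>D\<^esub> x) \<otimes>\<^bsub>D\<^esub> d \<oplus>\<^bsub>D\<^esub> s"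
      by (simp add: R.m_assoc canonical R.r_distr)
    then show ?thesis by (simp add: T_commute[OF s] R.m_assoc)
  qed
  have cancel: "(a \<oplus>\<^bsub>D\<^esub> s) \<ominus>\<^bsub>D\<^esub> a = s" if "a \<in> carrier D" for a
    using that by (simp add: R.minus_eq R.a_comm[of a s] R.a_assoc R.r_neg)
  have "ad (d \<otimes>\<^bsub>D\<^esub> s) = s" "ad (s \<otimes>\<^bsub>D\<^esub> d) = s"
    unfolding ad_def 1 2 using cancel by simp_all
  moreover have "ad ((d \<otimes>\<^bsub>D\<^esub> s \<ominus>\<^bsub>D\<^esub> s \<otimes>\<^bsub>D\<^esub> d) \<oplus>\<^bsub>D\<^esub> s \<otimes>\<^bsub>D\<^esub> d)
      = ad (d \<otimes>\<^bsub>D\<^esub> s \<ominus>\<^bsub>D\<^esub> s \<otimes>\<^bsub>D\<^esub> d) \<oplus>\<^bsub>D\<^esub> ad (s \<otimes>\<^bsub>D\<^esub> d)"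
    by (rule ad_add) (simp_all add: R.minus_eq S_closed d T_S s)
  moreover have "(d \<otimes>\<^bsub>D\<^esub> s \<ominus>\<^bsub>D\<^esub> s \<otimes>\<^bsub>D\<^esub> d) \<oplus>\<^bsub>D\<^esub> s \<otimes>\<^bsub>D\<^esub> d = d \<otimes>\<^bsub>D\<^esub> s"
    by (simp add: R.minus_eq R.a_assoc R.l_neg)
  ultimately have "s = ad (d \<otimes>\<^bsub>D\<^esub> s \<ominus>\<^bsub>D\<^esub> s \<otimes>\<^bsub>D\<^esub> d) \<oplus>\<^bsub>D\<^esub> s"
    by simp
  moreover have S': "d \<otimes>\<^bsub>D\<^esub> s \<ominus>\<^bsub>D\<^esub> s \<otimes>\<^bsub>D\<^esub> d \<in> S"
    by (simp add: R.minus_eq S_closed d T_S s)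
  ultimately have "ad (d \<otimes>\<^bsub>D\<^esub> s \<ominus>\<^bsub>D\<^esub> s \<otimes>\<^bsub>D\<^esub> d) = \<zero>\<^bsub>D\<^esub>"
    by (metis R.add.l_cancel_one' R.a_comm S_carrier ad_closed sc)
  then show ?thesis by (rule ad_eq_0[OF S'])
qed

text \<open>Supplies the denominators of antiderivatives: \<open>1/(N+1)\<close> is itself a
  constant, so dividing by \<open>N+1\<close> does not leave \<open>T\<close>.\<close>

lemma divide_T:
  assumes "t \<in> T"
  obtains u where "u \<in> T" "[Suc N] \<cdot>\<^bsub>D\<^esub> u = t"
proof -
  obtain q where q: "q \<in> S" "q \<otimes>\<^bsub>D\<^esub> x = x \<otimes>\<^bsub>D\<^esub> q" "[Suc N] \<cdot>\<^bsub>D\<^esub> q = \<one>\<^bsub>D\<^esub>"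
    using char_0 by blast
  have "q \<in> T" using q by (simp add: T_def)
  moreover have "[Suc N] \<cdot>\<^bsub>D\<^esub> (q \<otimes>\<^bsub>D\<^esub> t) = t"
    using R.add_pow_ldistr[of q t "Suc N"] q assms S_carrier T_carrier by (metis R.l_one)
  ultimately show ?thesis using that T_closed assms by blast
qed

lemma torsion_free:
  assumes "t \<in> T" "[Suc N] \<cdot>\<^bsub>D\<^esub> t = \<zero>\<^bsub>D\<^esub>"
  shows "t = \<zero>\<^bsub>D\<^esub>"
proof -
  obtain q where q: "q \<in> S" "[Suc N] \<cdot>\<^bsub>D\<^esub> q = \<one>\<^bsub>D\<^esub>"
    using char_0 by blast
  have "t = ([Suc N] \<cdot>\<^bsub>D\<^esub> q) \<otimes>\<^bsub>D\<^esub> t" using q assms T_carrier by simp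
  also have "\<dots> = q \<otimes>\<^bsub>D\<^esub> [Suc N] \<cdot>\<^bsub>D\<^esub> t"
    using q assms T_carrier S_carrier R.add_pow_ldistr R.add_pow_rdistr by metis
  finally show ?thesis using q assms S_carrier by simp
qed

section \<open>Extending a linear map from \<open>T\<close> to sums of powers of
  \<open>d\<close>\<close>

text \<open>The graph of \<open>(\<Sum>m<N. d\<^sup>m t\<^sub>m) \<mapsto> (\<Sum>m<N. d\<^sup>m z\<^sub>m)\<close> for \<open>(t\<^sub>m, z\<^sub>m) \<in> \<Gamma>\<close>.\<close>

inductive d_span :: "('a \<times> 'e) set \<Rightarrow> nat \<Rightarrow> 'a \<Rightarrow> 'e \<Rightarrow> bool" for \<Gamma> where
  zero: "d_span \<Gamma> 0 \<zero>\<^bsub>D\<^esub> \<zero>\<^bsub>E\<^esub>"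
| Suc: "d_span \<Gamma> N P y \<Longrightarrow> (t, z) \<in> \<Gamma> \<Longrightarrow>
    d_span \<Gamma> (Suc N) (P \<oplus>\<^bsub>D\<^esub> d [^]\<^bsub>D\<^esub> N \<otimes>\<^bsub>D\<^esub> t) (y \<oplus>\<^bsub>E\<^esub> d [^]\<^bsub>D\<^esub> N \<odot>\<^bsub>E\<^esub> z)"

context
  fixes \<Gamma>
  assumes G: "linear_graph T (regular_module D) E \<Gamma>" and dom: "Domain \<Gamma> \<subseteq> T"
begin

lemmas GD = linear_graphD[OF G, simplified]

lemma G_T: "(t, z) \<in> \<Gamma> \<Longrightarrow> t \<in> T" using dom by blast

lemma d_span_closed: "d_span \<Gamma> N P y \<Longrightarrow> P \<in> S \<and> y \<in> carrier E"
proof (induction rule: d_span.induct)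
  case (Suc N P y t z)
  then show ?case using G_T[OF Suc(2)] GD(2)[OF Suc(2)]
    by (simp add: S_closed pow_closed T_S smult_closed)
qed (simp add: S_closed)

lemma d_span_mono:
  assumes "d_span \<Gamma> N P y" "N \<le> N'"
  shows "d_span \<Gamma> N' P y"
  using assms(2)
proof (induction N' rule: dec_induct)
  case (step k)
  have "P \<in> carrier D" "y \<in> carrier E" using d_span_closed[OF assms(1)] S_carrier by auto
  then show ?case using d_span.Suc[OF step(3) GD(3)] by (simp add: smult_r_zero)
qed (rule assms(1))

lemma d_span_add_same:
  "d_span \<Gamma> N P y \<Longrightarrow> d_span \<Gamma> N Q w \<Longrightarrow> d_span \<Gamma> N (P \<oplus>\<^bsub>D\<^esub> Q) (y \<oplus>\<^bsub>E\<^esub> w)"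
proof (induction N arbitrary: P y Q w)
  case 0
  then show ?case by (auto elim!: d_span.cases intro: d_span.zero)
next
  case (Suc N)
  obtain P' y' t z where 1: "d_span \<Gamma> N P' y'" "(t, z) \<in> \<Gamma>"
    "P = P' \<oplus>\<^bsub>D\<^esub> d [^]\<^bsub>D\<^esub> N \<otimes>\<^bsub>D\<^esub> t" "y = y' \<oplus>\<^bsub>E\<^esub> d [^]\<^bsub>D\<^esub> N \<odot>\<^bsub>E\<^esub> z"
    using Suc.prems(1) by cases auto
  obtain Q' w' u v where 2: "d_span \<Gamma> N Q' w'" "(u, v) \<in> \<Gamma>"
    "Q = Q' \<oplus>\<^bsub>D\<^esub> d [^]\<^bsub>D\<^esub> N \<otimes>\<^bsub>D\<^esub> u" "w = w' \<oplus>\<^bsub>E\<^esub> d [^]\<^bsub>D\<^esub> N \<odot>\<^bsub>E\<^esub> v"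
    using Suc.prems(2) by cases auto
  have c: "P' \<in> carrier D" "Q' \<in> carrier D" "y' \<in> carrier E" "w' \<in> carrier E"
    using d_span_closed 1(1) 2(1) S_carrier by blast+
  have "d_span \<Gamma> (Suc N) ((P' \<oplus>\<^bsub>D\<^esub> Q') \<oplus>\<^bsub>D\<^esub> d [^]\<^bsub>D\<^esub> N \<otimes>\<^bsub>D\<^esub> (t \<oplus>\<^bsub>D\<^esub> u))
      ((y' \<oplus>\<^bsub>E\<^esub> w') \<oplus>\<^bsub>E\<^esub> d [^]\<^bsub>D\<^esub> N \<odot>\<^bsub>E\<^esub> (z \<oplus>\<^bsub>E\<^esub> v))"
    by (rule d_span.Suc[OF Suc.IH[OF 1(1) 2(1)] GD(4)[OF 1(2) 2(2)]])
  moreover have "(P' \<oplus>\<^bsub>D\<^esub> Q') \<oplus>\<^bsub>D\<^esub> d [^]\<^bsub>D\<^esub> N \<otimes>\<^bsub>D\<^esub> (t \<oplus>\<^bsub>D\<^esub> u) = P \<oplus>\<^bsub>D\<^esub> Q"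
    using c GD(1)[OF 1(2)] GD(1)[OF 2(2)] by (simp add: 1(3) 2(3) R.r_distr R.add.m_ac)
  moreover have "(y' \<oplus>\<^bsub>E\<^esub> w') \<oplus>\<^bsub>E\<^esub> d [^]\<^bsub>D\<^esub> N \<odot>\<^bsub>E\<^esub> (z \<oplus>\<^bsub>E\<^esub> v) = y \<oplus>\<^bsub>E\<^esub> w"
    using c GD(2)[OF 1(2)] GD(2)[OF 2(2)]
    by (simp add: 1(4) 2(4) smult_r_distr smult_closed M.add.m_ac)
  ultimately show ?case by simp
qed

lemma d_span_add:
  assumes "d_span \<Gamma> N P y" "d_span \<Gamma> N' Q w"
  shows "d_span \<Gamma> (max N N') (P \<oplus>\<^bsub>D\<^esub> Q) (y \<oplus>\<^bsub>E\<^esub> w)"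
  using d_span_add_same d_span_mono[OF assms(1)] d_span_mono[OF assms(2)] by simp

lemma d_span_d: "d_span \<Gamma> N P y \<Longrightarrow> d_span \<Gamma> (Suc N) (d \<otimes>\<^bsub>D\<^esub> P) (d \<odot>\<^bsub>E\<^esub> y)"
proof (induction rule: d_span.induct)
  case zero
  then show ?case using d_span_mono[OF d_span.zero, of "Suc 0"] by (simp add: smult_r_zero)
next
  case (Suc N P y t z)
  have c: "P \<in> carrier D" "y \<in> carrier E" "t \<in> carrier D" "z \<in> carrier E"
    using d_span_closed[OF Suc(1)] GD(1,2)[OF Suc(2)] S_carrier by auto
  have pow: "d [^]\<^bsub>D\<^esub> Suc N = d \<otimes>\<^bsub>D\<^esub> d [^]\<^bsub>D\<^esub> N" by (rule R.nat_pow_Suc2) simp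
  show ?case
    using d_span.Suc[OF Suc(3,2)] c unfolding pow
    by (simp add: R.r_distr smult_r_distr smult_closed R.m_assoc smult_assoc1)
qed

lemma d_span_pow:
  "d_span \<Gamma> N P y \<Longrightarrow> d_span \<Gamma> (M + N) (d [^]\<^bsub>D\<^esub> M \<otimes>\<^bsub>D\<^esub> P) (d [^]\<^bsub>D\<^esub> M \<odot>\<^bsub>E\<^esub> y)"
proof (induction M)
  case 0
  then show ?case using d_span_closed[OF 0] S_carrier by (simp add: smult_one)
next
  case (Suc M)
  then show ?case using d_span_closed[OF Suc.prems] S_carrier d_span_d[OF Suc.IH[OF Suc.prems]] R.nat_pow_Suc2[of d M]
    by (simp add: R.m_assoc smult_assoc1 del: R.nat_pow_Suc)
qed

lemma d_span_base: "(t, z) \<in> \<Gamma> \<Longrightarrow> d_span \<Gamma> (Suc 0) t z"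
  using d_span.Suc[OF d_span.zero, of t z] GD(1,2) by (simp add: smult_one)

text \<open>Rewriting \<open>s d = d s + c\<close> with \<open>c\<close> in \<open>T\<close> pushes
  the scalar through the power of \<open>d\<close> until it meets \<open>\<Gamma>\<close>, which is
  stable under \<open>T\<close>. The scalar has to be arbitrary in the induction, because the second
  summand uses the hypothesis for \<open>c\<close> in place of \<open>s\<close>. The same rewriting
  on the side of \<open>E\<close> keeps the values in step.\<close>

lemma d_span_T_monomial:
  "s \<in> T \<Longrightarrow> (t, z) \<in> \<Gamma> \<Longrightarrow>
    d_span \<Gamma> (Suc N) (s \<otimes>\<^bsub>D\<^esub> (d [^]\<^bsub>D\<^esub> N \<otimes>\<^bsub>D\<^esub> t)) (s \<odot>\<^bsub>E\<^esub> (d [^]\<^bsub>D\<^esub> N \<odot>\<^bsub>E\<^esub> z))"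
proof (induction N arbitrary: s)
  case 0
  then show ?case using d_span_base[OF GD(5)[OF 0]] GD(1,2)[OF 0(2)] by (simp add: smult_one)
next
  case (Suc N)
  define c where "c = \<ominus>\<^bsub>D\<^esub> (d \<otimes>\<^bsub>D\<^esub> s \<ominus>\<^bsub>D\<^esub> s \<otimes>\<^bsub>D\<^esub> d)"
  let ?t = "d [^]\<^bsub>D\<^esub> N \<otimes>\<^bsub>D\<^esub> t" and ?z = "d [^]\<^bsub>D\<^esub> N \<odot>\<^bsub>E\<^esub> z"
  have cl: "s \<in> carrier D" "t \<in> carrier D" "z \<in> carrier E"
    using T_carrier Suc.prems GD(1,2)[OF Suc.prems(2)] by auto
  have cz: "?t \<in> carrier D" "?z \<in> carrier E" using cl by (auto simp: smult_closed)
  have m: "c \<in> T" unfolding c_def using commutator_T[OF Suc.prems(1)] T_closed by blast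
  have sd: "s \<otimes>\<^bsub>D\<^esub> d = d \<otimes>\<^bsub>D\<^esub> s \<oplus>\<^bsub>D\<^esub> c"
    unfolding c_def using cl by (simp add: R.minus_eq R.minus_add R.r_neg2 R.a_assoc[symmetric] R.r_neg)
  have "d_span \<Gamma> (max (Suc (Suc N)) (Suc N))
      (d \<otimes>\<^bsub>D\<^esub> (s \<otimes>\<^bsub>D\<^esub> ?t) \<oplus>\<^bsub>D\<^esub> c \<otimes>\<^bsub>D\<^esub> ?t) (d \<odot>\<^bsub>E\<^esub> (s \<odot>\<^bsub>E\<^esub> ?z) \<oplus>\<^bsub>E\<^esub> c \<odot>\<^bsub>E\<^esub> ?z)"
    by (rule d_span_add[OF d_span_d[OF Suc.IH[OF Suc.prems]] Suc.IH[OF m Suc.prems(2)]])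
  moreover have "d \<otimes>\<^bsub>D\<^esub> (s \<otimes>\<^bsub>D\<^esub> ?t) \<oplus>\<^bsub>D\<^esub> c \<otimes>\<^bsub>D\<^esub> ?t = (s \<otimes>\<^bsub>D\<^esub> d) \<otimes>\<^bsub>D\<^esub> ?t"
    unfolding sd using cl cz T_carrier[OF m] by (simp add: R.l_distr R.m_assoc)
  moreover have "d \<odot>\<^bsub>E\<^esub> (s \<odot>\<^bsub>E\<^esub> ?z) \<oplus>\<^bsub>E\<^esub> c \<odot>\<^bsub>E\<^esub> ?z = (s \<otimes>\<^bsub>D\<^esub> d) \<odot>\<^bsub>E\<^esub> ?z"
    unfolding sd using cl cz T_carrier[OF m] by (simp add: smult_l_distr smult_assoc1)
  moreover have "(s \<otimes>\<^bsub>D\<^esub> d) \<otimes>\<^bsub>D\<^esub> ?t = s \<otimes>\<^bsub>D\<^esub> (d [^]\<^bsub>D\<^esub> Suc N \<otimes>\<^bsub>D\<^esub> t)"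
    using cl R.nat_pow_Suc2[of d N] by (simp add: R.m_assoc del: R.nat_pow_Suc)
  moreover have "(s \<otimes>\<^bsub>D\<^esub> d) \<odot>\<^bsub>E\<^esub> ?z = s \<odot>\<^bsub>E\<^esub> (d [^]\<^bsub>D\<^esub> Suc N \<odot>\<^bsub>E\<^esub> z)"
    using cl cz R.nat_pow_Suc2[of d N] by (simp add: smult_assoc1 smult_closed del: R.nat_pow_Suc)
  ultimately show ?case by simp
qed

lemma d_span_T: "d_span \<Gamma> N P y \<Longrightarrow> s \<in> T \<Longrightarrow> d_span \<Gamma> N (s \<otimes>\<^bsub>D\<^esub> P) (s \<odot>\<^bsub>E\<^esub> y)"
proof (induction rule: d_span.induct)
  case zero
  then show ?case using d_span.zero by (simp add: smult_r_zero T_carrier)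
next
  case (Suc N P y t z)
  have c: "P \<in> carrier D" "y \<in> carrier E" "t \<in> carrier D" "z \<in> carrier E"
    using d_span_closed[OF Suc(1)] GD(1,2)[OF Suc(2)] S_carrier by auto
  then show ?case
    using d_span_add[OF Suc(3)[OF Suc(4)] d_span_T_monomial[OF Suc(4,2), of N]] T_carrier[OF Suc(4)]
    by (simp add: R.r_distr smult_r_distr smult_closed max_def split: if_splits)
qed

end

section \<open>Expansions of elements of \<open>S\<close> in powers of \<open>d\<close>\<close>

text \<open>With all values zero, \<open>d_span\<close> describes plain sums of terms
  \<open>d\<^sup>m t\<^sub>m\<close> with coefficients in \<open>T\<close>, so its closure lemmas
  also serve for expansions in \<open>S\<close>.\<close>

lemma linear_graph_T: "linear_graph T (regular_module D) E (T \<times> {\<zero>\<^bsub>E\<^esub>})"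
  unfolding linear_graph_def by (auto simp: T_closed T_carrier smult_r_zero)

abbreviation taylor :: "nat \<Rightarrow> 'a \<Rightarrow> bool"
  where "taylor N P \<equiv> \<exists>y. d_span (T \<times> {\<zero>\<^bsub>E\<^esub>}) N P y"

lemma taylor_Suc: "taylor N P \<Longrightarrow> t \<in> T \<Longrightarrow> taylor (Suc N) (P \<oplus>\<^bsub>D\<^esub> d [^]\<^bsub>D\<^esub> N \<otimes>\<^bsub>D\<^esub> t)"
  using d_span.Suc by blast

lemma taylor_closed: "taylor N P \<Longrightarrow> P \<in> S"
  using d_span_closed[OF linear_graph_T] by auto

text \<open>Differentiation term by term lowers each exponent by one and kills the term of exponent
  0. The subtraction is truncated: the empty sum keeps length 0, and so does the derivative of a sum
  of length 1.\<close>

lemma taylor_ad: "d_span (T \<times> {\<zero>\<^bsub>E\<^esub>}) N P y \<Longrightarrow> taylor (N - 1) (ad P)"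
proof (induction rule: d_span.induct)
  case zero
  then show ?case using d_span.zero ad_T T_closed(1) by auto
next
  case (Suc N P y t z)
  have t: "t \<in> T" using Suc(2) by simp
  have "P \<in> S" using taylor_closed Suc(1) by blast
  then have ad: "ad (P \<oplus>\<^bsub>D\<^esub> d [^]\<^bsub>D\<^esub> N \<otimes>\<^bsub>D\<^esub> t) = ad P \<oplus>\<^bsub>D\<^esub> ad (d [^]\<^bsub>D\<^esub> N \<otimes>\<^bsub>D\<^esub> t)"
    by (rule ad_add) (simp add: S_closed pow_closed T_S[OF t])
  show ?case
  proof (cases N)
    case 0
    then have "ad (d [^]\<^bsub>D\<^esub> N \<otimes>\<^bsub>D\<^esub> t) = \<zero>\<^bsub>D\<^esub>" using t T_carrier by (simp add: ad_T)
    then show ?thesis using Suc(3) 0 ad ad_closed[OF \<open>P \<in> S\<close>] S_carrier by simp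
  next
    case (Suc N')
    then show ?thesis
      using \<open>taylor (N - 1) (ad P)\<close> taylor_Suc[of N' "ad P" "[Suc N'] \<cdot>\<^bsub>D\<^esub> t"] add_pow_closed[OF t]
      unfolding Suc ad[unfolded Suc] ad_pow[OF t] by (simp del: R.nat_pow_Suc R.add.nat_pow_Suc)
  qed
qed

text \<open>Termwise antiderivative: \<open>d\<^sup>m t\<close> is replaced by
  \<open>d\<^sup>m\<^sup>+\<^sup>1 u\<close> with \<open>(m+1) u = t\<close>.\<close>

lemma taylor_integral:
  "d_span (T \<times> {\<zero>\<^bsub>E\<^esub>}) N P y \<Longrightarrow> \<exists>Q. taylor (Suc N) Q \<and> ad Q = P"
proof (induction rule: d_span.induct)
  case zero
  \<comment> \<open>The antiderivative is one term longer, so zero has to be presented with a zero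
    coefficient in degree 0 and not as the empty sum.\<close>
  have "taylor (Suc 0) \<zero>\<^bsub>D\<^esub>" using d_span_base[OF linear_graph_T] T_closed(1) by blast
  then show ?case using ad_T[OF T_closed(1)] by blast
next
  case (Suc N P y t z)
  then obtain Q where Q: "taylor (Suc N) Q" "ad Q = P" by blast
  obtain u where u: "u \<in> T" "[Suc N] \<cdot>\<^bsub>D\<^esub> u = t" using divide_T Suc(2) by blast
  have "ad (Q \<oplus>\<^bsub>D\<^esub> d [^]\<^bsub>D\<^esub> Suc N \<otimes>\<^bsub>D\<^esub> u) = P \<oplus>\<^bsub>D\<^esub> d [^]\<^bsub>D\<^esub> N \<otimes>\<^bsub>D\<^esub> t"
    using ad_add[OF taylor_closed[OF Q(1)], of "d [^]\<^bsub>D\<^esub> Suc N \<otimes>\<^bsub>D\<^esub> u"]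
      pow_closed[of "Suc N"] S_closed(4) T_S[OF u(1)]
    unfolding ad_pow[OF u(1)] Q(2) u(2) by blast
  then show ?case using taylor_Suc[OF Q(1) u(1)] by blast
qed

text \<open>Induction on the filtration: \<open>ad P\<close> lies one level lower and has an
  expansion, whose antiderivative \<open>Q\<close> satisfies \<open>ad Q = ad P\<close>. Then
  \<open>P - Q\<close> is a constant, that is, an element of \<open>T\<close>, and counts as an
  expansion of length 1. At level 0 the element \<open>P\<close> itself is a constant.\<close>

lemma taylor_exists: "P \<in> S \<Longrightarrow> \<exists>N. taylor N P"
proof -
  have *: "\<exists>N. taylor N P" if "P \<in> T" for P
    using d_span_base[OF linear_graph_T] that by blast
  have "\<exists>N. taylor N P" if "P \<in> S" "P \<in> F k" for k
    using that
  proof (induction k arbitrary: P)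
    case 0
    then show ?case using * F_0 by (simp add: T_def)
  next
    case (Suc k)
    then obtain N where "taylor N (ad P)"
      using F_Suc ad_closed unfolding ad_def by blast
    then obtain Q where Q: "taylor (Suc N) Q" "ad Q = ad P"
      using taylor_integral by blast
    have QS: "Q \<in> S" using taylor_closed[OF Q(1)] .
    have PQ: "P \<ominus>\<^bsub>D\<^esub> Q \<in> S" using Suc.prems(1) QS by (simp add: R.minus_eq S_closed)
    have P: "P = (P \<ominus>\<^bsub>D\<^esub> Q) \<oplus>\<^bsub>D\<^esub> Q"
      using Suc.prems(1) QS by (simp add: R.minus_eq S_carrier R.a_assoc R.l_neg)
    have "ad P = ad (P \<ominus>\<^bsub>D\<^esub> Q) \<oplus>\<^bsub>D\<^esub> ad P"
      using ad_add[OF PQ QS] P Q(2) by simp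
    then have "ad (P \<ominus>\<^bsub>D\<^esub> Q) = \<zero>\<^bsub>D\<^esub>"
      using ad_closed[OF PQ] ad_closed[OF Suc.prems(1)] S_carrier
      by (metis R.add.l_cancel_one' R.a_comm)
    then have "\<exists>M. taylor M (P \<ominus>\<^bsub>D\<^esub> Q)" using * ad_eq_0[OF PQ] by blast
    then show ?case
      using d_span_add[OF linear_graph_T] Q(1) P by (metis Domain_fst fst_image_times order_refl insert_not_empty)
  qed
  then show "P \<in> S \<Longrightarrow> ?thesis" using exhaust by blast
qed

text \<open>Uniqueness of coefficients: differentiating the relation shortens it and multiplies the
  leading coefficient by a positive integer, which \<open>torsion_free\<close> removes.\<close>

lemma leading_coeff_0:
  "taylor N P \<Longrightarrow> t \<in> T \<Longrightarrow> P \<oplus>\<^bsub>D\<^esub> d [^]\<^bsub>D\<^esub> N \<otimes>\<^bsub>D\<^esub> t = \<zero>\<^bsub>D\<^esub> \<Longrightarrow> t = \<zero>\<^bsub>D\<^esub>"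
proof (induction N arbitrary: P t)
  case 0
  then show ?case using T_carrier by (auto elim!: d_span.cases)
next
  case (Suc N)
  have PS: "P \<in> S" using taylor_closed Suc.prems(1) .
  have "ad P \<oplus>\<^bsub>D\<^esub> d [^]\<^bsub>D\<^esub> N \<otimes>\<^bsub>D\<^esub> [Suc N] \<cdot>\<^bsub>D\<^esub> t = ad \<zero>\<^bsub>D\<^esub>"
    using ad_add[OF PS, of "d [^]\<^bsub>D\<^esub> Suc N \<otimes>\<^bsub>D\<^esub> t"] pow_closed[of "Suc N"] S_closed(4)
      T_S[OF Suc.prems(2)] unfolding ad_pow[OF Suc.prems(2)] Suc.prems(3) by simp
  moreover have "taylor N (ad P)" using taylor_ad Suc.prems(1) by fastforce
  ultimately have "[Suc N] \<cdot>\<^bsub>D\<^esub> t = \<zero>\<^bsub>D\<^esub>"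
    using Suc.IH[of "ad P" "[Suc N] \<cdot>\<^bsub>D\<^esub> t"] add_pow_closed[OF Suc.prems(2), of "Suc N"]
      ad_T[OF T_closed(1)] by metis
  then show ?case using torsion_free Suc.prems(2) by blast
qed

text \<open>\<open>\<Delta>\<close> is the extension of \<open>\<Gamma>\<close> to the left ideal of
  \<open>S\<close> generated by \<open>Domain \<Gamma>\<close>. An element \<open>e\<close>
  representing \<open>\<Delta>\<close> also represents \<open>\<Gamma>\<close>, because pairs of
  \<open>\<Gamma>\<close> are sums of length 1.\<close>

lemma baer_on_T:
  assumes baer: "baer_on S D E"
  shows "baer_on T D E"
  unfolding baer_on_def
proof (intro allI impI, elim conjE)
  fix \<Gamma> assume G: "linear_graph T (regular_module D) E \<Gamma>" and dom: "Domain \<Gamma> \<subseteq> T"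
  note GD = linear_graphD[OF G, simplified]
  define \<Delta> where "\<Delta> = {(P, y). \<exists>N. d_span \<Gamma> N P y}"
  have taylor: "taylor N P" if "d_span \<Gamma> N P y" for N P y
    using that
  proof (induction rule: d_span.induct)
    case (Suc N P y t z)
    then show ?case using taylor_Suc dom by blast
  qed (use d_span.zero in blast)
  \<comment> \<open>The top term is peeled off: its coefficient vanishes by uniqueness, then its
    value vanishes because \<open>\<Gamma>\<close> is single-valued at zero, and a shorter sum
    remains.\<close>
  have unique: "y = \<zero>\<^bsub>E\<^esub>" if "d_span \<Gamma> N \<zero>\<^bsub>D\<^esub> y" for N y
    using that
  proof (induction N arbitrary: y)
    case 0
    then show ?case by (auto elim: d_span.cases)
  next
    case (Suc N)
    from Suc.prems obtain P' y' t z where 1: "d_span \<Gamma> N P' y'" "(t, z) \<in> \<Gamma>"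
      "\<zero>\<^bsub>D\<^esub> = P' \<oplus>\<^bsub>D\<^esub> d [^]\<^bsub>D\<^esub> N \<otimes>\<^bsub>D\<^esub> t" "y = y' \<oplus>\<^bsub>E\<^esub> d [^]\<^bsub>D\<^esub> N \<odot>\<^bsub>E\<^esub> z"
      by cases auto
    have t: "t = \<zero>\<^bsub>D\<^esub>"
      using leading_coeff_0[OF taylor[OF 1(1)] _ 1(3)[symmetric]] 1(2) dom by blast
    then have z: "z = \<zero>\<^bsub>E\<^esub>" using GD(6) 1(2) by blast
    have "P' = \<zero>\<^bsub>D\<^esub>" using 1(3) t S_carrier d_span_closed[OF G dom 1(1)] by simp
    then have "y' = \<zero>\<^bsub>E\<^esub>" using Suc.IH 1(1) by blast
    then show ?case using 1(4) z by (simp add: smult_r_zero)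
  qed
  \<comment> \<open>The multiplier \<open>s\<close> is itself expanded in powers of
    \<open>d\<close>, with dummy values \<open>w\<close>. Each term \<open>d\<^sup>M t\<close> acts
    in two stages, first \<open>t\<close> by commutation and then the power by raising
    exponents.\<close>
  have S_mult: "\<exists>K. d_span \<Gamma> K (s \<otimes>\<^bsub>D\<^esub> P) (s \<odot>\<^bsub>E\<^esub> y)"
    if P: "d_span \<Gamma> N P y" and s: "d_span (T \<times> {\<zero>\<^bsub>E\<^esub>}) M s w" for s w M N P y
    using s
  proof (induction rule: d_span.induct)
    case zero
    then show ?case using d_span_closed[OF G dom P] S_carrier d_span.zero by (auto simp: smult_l_zero)
  next
    case (Suc M s w t z)
    then obtain K where K: "d_span \<Gamma> K (s \<otimes>\<^bsub>D\<^esub> P) (s \<odot>\<^bsub>E\<^esub> y)" by blast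
    have t: "t \<in> T" using Suc(2) by simp
    have c: "s \<in> carrier D" "t \<in> carrier D" "P \<in> carrier D" "y \<in> carrier E"
      using taylor_closed Suc(1) T_carrier[OF t] d_span_closed[OF G dom P] S_carrier by blast+
    show ?case
      using d_span_add[OF G dom K d_span_pow[OF G dom d_span_T[OF G dom P t], of M]] c
      by (auto simp: R.l_distr smult_l_distr R.m_assoc smult_assoc1)
  qed
  have "linear_graph S (regular_module D) E \<Delta>"
    unfolding linear_graph_def
  proof (intro conjI allI impI ballI)
    show "\<Delta> \<subseteq> carrier (regular_module D) \<times> carrier E"
      using d_span_closed[OF G dom] S_carrier by (auto simp: \<Delta>_def)
    show "(\<zero>\<^bsub>regular_module D\<^esub>, \<zero>\<^bsub>E\<^esub>) \<in> \<Delta>" using d_span.zero by (auto simp: \<Delta>_def)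
  next
    fix P y Q z assume "(P, y) \<in> \<Delta>" "(Q, z) \<in> \<Delta>"
    then show "(P \<oplus>\<^bsub>regular_module D\<^esub> Q, y \<oplus>\<^bsub>E\<^esub> z) \<in> \<Delta>"
      unfolding \<Delta>_def using d_span_add[OF G dom] by (simp, blast)
  next
    fix s P y assume "s \<in> S" "(P, y) \<in> \<Delta>"
    then show "(s \<odot>\<^bsub>regular_module D\<^esub> P, s \<odot>\<^bsub>E\<^esub> y) \<in> \<Delta>"
      using S_mult taylor_exists unfolding \<Delta>_def by fastforce
  next
    fix y assume "(\<zero>\<^bsub>regular_module D\<^esub>, y) \<in> \<Delta>"
    then show "y = \<zero>\<^bsub>E\<^esub>" using unique by (auto simp: \<Delta>_def)
  qed
  moreover have "Domain \<Delta> \<subseteq> S" using d_span_closed[OF G dom] by (auto simp: \<Delta>_def)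
  ultimately obtain e where "e \<in> carrier E" "\<And>P y. (P, y) \<in> \<Delta> \<Longrightarrow> y = P \<odot>\<^bsub>E\<^esub> e"
    by (rule baer_onE[OF baer]) blast
  then show "\<exists>e\<in>carrier E. \<forall>a y. (a, y) \<in> \<Gamma> \<longrightarrow> y = a \<odot>\<^bsub>E\<^esub> e"
    using d_span_base[OF G dom] unfolding \<Delta>_def by blast
qed

end

section \<open>Rings of differential operators\<close>

lemma diff_op_ring_simps [simp]:
  "carrier (diff_op_ring K A) = (\<Union>k. diff_ops_of_order K A k)"
  "P \<otimes>\<^bsub>diff_op_ring K A\<^esub> Q = compose (carrier A) P Q"
  "\<one>\<^bsub>diff_op_ring K A\<^esub> = (\<lambda>f\<in>carrier A. f)"
  "\<zero>\<^bsub>diff_op_ring K A\<^esub> = (\<lambda>f\<in>carrier A. \<zero>\<^bsub>A\<^esub>)"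
  "P \<oplus>\<^bsub>diff_op_ring K A\<^esub> Q = (\<lambda>f\<in>carrier A. P f \<oplus>\<^bsub>A\<^esub> Q f)"
  by (simp_all add: diff_op_ring_def)

lemma restrict_scalars_simps [simp]:
  "carrier (restrict_scalars \<phi> E) = carrier E"
  "\<zero>\<^bsub>restrict_scalars \<phi> E\<^esub> = \<zero>\<^bsub>E\<^esub>"
  "x \<oplus>\<^bsub>restrict_scalars \<phi> E\<^esub> y = x \<oplus>\<^bsub>E\<^esub> y"
  "a \<odot>\<^bsub>restrict_scalars \<phi> E\<^esub> x = \<phi> a \<odot>\<^bsub>E\<^esub> x"
  by (simp_all add: restrict_scalars_def)

lemma left_module_restrict_scalars:
  assumes E: "left_module D E" and A: "ring A"
    and closed: "\<And>a. a \<in> carrier A \<Longrightarrow> \<phi> a \<in> carrier D"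
    and add: "\<And>a b. a \<in> carrier A \<Longrightarrow> b \<in> carrier A \<Longrightarrow> \<phi> (a \<oplus>\<^bsub>A\<^esub> b) = \<phi> a \<oplus>\<^bsub>D\<^esub> \<phi> b"
    and mult: "\<And>a b. a \<in> carrier A \<Longrightarrow> b \<in> carrier A \<Longrightarrow> \<phi> (a \<otimes>\<^bsub>A\<^esub> b) = \<phi> a \<otimes>\<^bsub>D\<^esub> \<phi> b"
    and one: "\<phi> \<one>\<^bsub>A\<^esub> = \<one>\<^bsub>D\<^esub>"
  shows "left_module A (restrict_scalars \<phi> E)"
proof -
  interpret E: left_module D E by (rule E)
  interpret A: ring A by (rule A)
  have "abelian_group (restrict_scalars \<phi> E)"
    by (rule abelian_groupI)
      (use E.M.l_neg in \<open>auto simp: E.M.add.m_ac intro: bexI[of _ "\<ominus>\<^bsub>E\<^esub> x" for x]\<close>)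
  then interpret r: abelian_group "restrict_scalars \<phi> E" .
  show ?thesis
    by unfold_locales
      (simp_all add: closed add mult one E.smult_closed E.smult_l_distr E.smult_r_distr
        E.smult_assoc1 E.smult_one)
qed

text \<open>Assumption \<open>xs_linear\<close> says that the operators commuting with the variables are the
  multiplications. It is the only place where the nature of \<open>A\<close> (beyond its having partial
  derivatives) enters.\<close>

locale weyl_algebra = cring A
  for K :: "('k, 'x) ring_scheme" and A :: "('k, 'r) module" (structure) +
  fixes n :: nat and xs :: "nat \<Rightarrow> 'r" and ds :: "nat \<Rightarrow> 'r \<Rightarrow> 'r"
  assumes smult_closed: "c \<in> carrier K \<Longrightarrow> f \<in> carrier A \<Longrightarrow> c \<odot> f \<in> carrier A"
    and smult_assoc: "c \<in> carrier K \<Longrightarrow> f \<in> carrier A \<Longrightarrow> g \<in> carrier A \<Longrightarrow>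
      (c \<odot> f) \<otimes> g = c \<odot> (f \<otimes> g)"
    and xs_closed: "i < n \<Longrightarrow> xs i \<in> carrier A"
    and ds_linear: "i < n \<Longrightarrow> ds i \<in> linear_endos K A"
    and ds_mult: "i < n \<Longrightarrow> f \<in> carrier A \<Longrightarrow> g \<in> carrier A \<Longrightarrow>
      ds i (f \<otimes> g) = ds i f \<otimes> g \<oplus> f \<otimes> ds i g"
    and ds_xs: "i < n \<Longrightarrow> j < n \<Longrightarrow> ds i (xs j) = (if i = j then \<one> else \<zero>)"
    and rational: "\<exists>c\<in>carrier A. [Suc N] \<cdot> c = \<one>"
    and xs_linear: "P \<in> linear_endos K A \<Longrightarrow>
      (\<And>i g. i < n \<Longrightarrow> g \<in> carrier A \<Longrightarrow> P (xs i \<otimes> g) = xs i \<otimes> P g) \<Longrightarrow>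
      f \<in> carrier A \<Longrightarrow> P f = P \<one> \<otimes> f"
begin

abbreviation D :: "('r \<Rightarrow> 'r) ring" where "D \<equiv> diff_op_ring K A"

lemma diff_ops_linear: "P \<in> diff_ops_of_order K A k \<Longrightarrow> P \<in> linear_endos K A"
  by (cases k) auto

lemma D_linear: "P \<in> carrier D \<Longrightarrow> P \<in> linear_endos K A"
  using diff_ops_linear by auto

lemma linear_endosD:
  assumes "P \<in> linear_endos K A"
  shows "f \<in> carrier A \<Longrightarrow> P f \<in> carrier A"
    "f \<in> carrier A \<Longrightarrow> g \<in> carrier A \<Longrightarrow> P (f \<oplus> g) = P f \<oplus> P g"
    "P \<in> extensional (carrier A)"
  using assms by (auto simp: linear_endos_def PiE_def)

lemma linear_endos_ext:
  assumes "P \<in> linear_endos K A" "Q \<in> linear_endos K A" "\<And>f. f \<in> carrier A \<Longrightarrow> P f = Q f"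
  shows "P = Q"
  using assms by (intro extensionalityI[of P "carrier A" Q]) (auto dest: linear_endosD(3))

section \<open>Multiplications and derivations as differential operators\<close>

lemma mult_op_linear: "r \<in> carrier A \<Longrightarrow> mult_op A r \<in> linear_endos K A"
  unfolding linear_endos_def mult_op_def
  using smult_assoc[of _ _ r] by (auto simp: r_distr smult_closed m_comm[of r])

lemma mult_op_order_0: "r \<in> carrier A \<Longrightarrow> mult_op A r \<in> diff_ops_of_order K A 0"
  using mult_op_linear
  by (auto simp: commutator_op_def mult_op_def m_lcomm minus_eq r_neg restrict_def fun_eq_iff)

lemma mult_op_closed: "r \<in> carrier A \<Longrightarrow> mult_op A r \<in> carrier D"
  using mult_op_order_0 by (auto simp del: diff_ops_of_order.simps)

lemma mult_op_apply: "f \<in> carrier A \<Longrightarrow> mult_op A r f = r \<otimes> f"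
  by (simp add: mult_op_def)

lemma mult_op_one: "mult_op A \<one> = \<one>\<^bsub>D\<^esub>"
  by (auto simp: mult_op_def)

lemma mult_op_add: "r \<in> carrier A \<Longrightarrow> s \<in> carrier A \<Longrightarrow> mult_op A (r \<oplus> s) = mult_op A r \<oplus>\<^bsub>D\<^esub> mult_op A s"
  by (auto simp: mult_op_def l_distr)

lemma mult_op_mult: "r \<in> carrier A \<Longrightarrow> s \<in> carrier A \<Longrightarrow> mult_op A (r \<otimes> s) = mult_op A r \<otimes>\<^bsub>D\<^esub> mult_op A s"
  by (auto simp: mult_op_def compose_def m_assoc)

lemma mult_op_commute:
  "r \<in> carrier A \<Longrightarrow> s \<in> carrier A \<Longrightarrow> mult_op A r \<otimes>\<^bsub>D\<^esub> mult_op A s = mult_op A s \<otimes>\<^bsub>D\<^esub> mult_op A r"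
  by (simp only: m_comm flip: mult_op_mult)

lemma mult_op_inj: "r \<in> carrier A \<Longrightarrow> mult_op A r = \<zero>\<^bsub>D\<^esub> \<Longrightarrow> r = \<zero>"
  using mult_op_apply[of \<one> r] by simp

text \<open>By the Leibniz rule the commutator of a derivation with \<open>r\<close> is
  multiplication by the derivative of \<open>r\<close>, an operator of order 0.\<close>

lemma ds_order_1:
  assumes i: "i < n"
  shows "ds i \<in> diff_ops_of_order K A (Suc 0)"
proof -
  have "commutator_op A (ds i) r = mult_op A (ds i r)" if r: "r \<in> carrier A" for r
    unfolding commutator_op_def mult_op_def
    using r i linear_endosD(1)[OF ds_linear[OF i]]
    by (intro restrict_ext) (simp add: ds_mult minus_eq a_assoc r_neg)
  then show ?thesis
    using ds_linear[OF i] mult_op_order_0 linear_endosD(1)[OF ds_linear[OF i]]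
    by (simp only: diff_ops_of_order.simps(2)) simp
qed

lemma ds_closed: "i < n \<Longrightarrow> ds i \<in> carrier D"
  using ds_order_1 by (auto simp del: diff_ops_of_order.simps)

text \<open>The ring axioms of \<open>D\<close> enter as a hypothesis here; they will be supplied by
  \<open>left_module D E\<close>, which contains them.\<close>

context
  assumes D: "ring D"
begin

interpretation D: ring D by (rule D)

text \<open>Negation in \<open>D\<close> is only characterised as the additive inverse, so the
  pointwise formula is recovered by evaluating \<open>P = (P - Q) + Q\<close> at
  \<open>f\<close>.\<close>

lemma D_minus_apply:
  assumes P: "P \<in> carrier D" and Q: "Q \<in> carrier D" and f: "f \<in> carrier A"
  shows "(P \<ominus>\<^bsub>D\<^esub> Q) f = P f \<ominus> Q f"
proof -
  have PQ: "P \<ominus>\<^bsub>D\<^esub> Q \<in> carrier D" using P Q by (rule D.minus_closed)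
  have "P = (P \<ominus>\<^bsub>D\<^esub> Q) \<oplus>\<^bsub>D\<^esub> Q"
    using P Q by (simp add: D.minus_eq D.a_assoc D.l_neg del: diff_op_ring_simps)
  from fun_cong[OF this, of f] have "P f = (P \<ominus>\<^bsub>D\<^esub> Q) f \<oplus> Q f"
    using f unfolding diff_op_ring_simps(5) by simp
  then show ?thesis
    using linear_endosD(1)[OF D_linear[OF PQ] f] linear_endosD(1)[OF D_linear[OF Q] f]
    by (simp add: minus_eq a_assoc r_neg)
qed

lemma commutator_op_eq:
  assumes P: "P \<in> carrier D" and r: "r \<in> carrier A"
  shows "P \<otimes>\<^bsub>D\<^esub> mult_op A r \<ominus>\<^bsub>D\<^esub> mult_op A r \<otimes>\<^bsub>D\<^esub> P = commutator_op A P r"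
proof (rule extensionalityI[where A = "carrier A"])
  have c: "P \<otimes>\<^bsub>D\<^esub> mult_op A r \<in> carrier D" "mult_op A r \<otimes>\<^bsub>D\<^esub> P \<in> carrier D"
    using P mult_op_closed[OF r] by (rule D.m_closed D.m_closed[rotated])+
  show "P \<otimes>\<^bsub>D\<^esub> mult_op A r \<ominus>\<^bsub>D\<^esub> mult_op A r \<otimes>\<^bsub>D\<^esub> P \<in> extensional (carrier A)"
    by (rule linear_endosD(3)[OF D_linear[OF D.minus_closed[OF c]]])
  show "commutator_op A P r \<in> extensional (carrier A)" by (simp add: commutator_op_def)
  fix f assume f: "f \<in> carrier A"
  show "(P \<otimes>\<^bsub>D\<^esub> mult_op A r \<ominus>\<^bsub>D\<^esub> mult_op A r \<otimes>\<^bsub>D\<^esub> P) f = commutator_op A P r f"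
    unfolding D_minus_apply[OF c f]
    using f linear_endosD(1)[OF D_linear[OF P] f]
    by (simp add: commutator_op_def compose_def mult_op_apply)
qed

section \<open>The chain of centralizers\<close>

definition centralizer :: "nat \<Rightarrow> ('r \<Rightarrow> 'r) set" where
  "centralizer j = {P \<in> carrier D. \<forall>i<j. P \<otimes>\<^bsub>D\<^esub> mult_op A (xs i) = mult_op A (xs i) \<otimes>\<^bsub>D\<^esub> P}"

text \<open>The order filtration plays the part of \<open>F\<close>: by
  \<open>commutator_op_eq\<close> the commutator formed in \<open>D\<close> is the one by which the
  order is defined.\<close>

lemma weyl_step_centralizer:
  assumes E: "left_module D E" and j: "j < n" and S: "subring (centralizer j) D"
  shows "weyl_step D E (centralizer j) (ds j) (mult_op A (xs j)) (diff_ops_of_order K A)"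
proof -
  interpret E: left_module D E by (rule E)
  note xj = xs_closed[OF j]
  have dj: "ds j f \<in> carrier A" if "f \<in> carrier A" for f
    using linear_endosD(1)[OF ds_linear[OF j] that] .
  have ds_x: "ds j \<otimes>\<^bsub>D\<^esub> mult_op A (xs i) = (\<lambda>f\<in>carrier A. (if i = j then f else \<zero>) \<oplus> xs i \<otimes> ds j f)"
    if i: "i < n" for i
    unfolding diff_op_ring_simps compose_def
    by (intro restrict_ext) (use i j xs_closed[OF i] in \<open>simp add: mult_op_apply ds_mult ds_xs dj\<close>)
  have x_ds: "mult_op A (xs i) \<otimes>\<^bsub>D\<^esub> ds j = (\<lambda>f\<in>carrier A. xs i \<otimes> ds j f)" for i
    unfolding diff_op_ring_simps compose_def
    by (intro restrict_ext) (simp add: mult_op_apply dj)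
  show ?thesis
  proof (intro weyl_step.intro weyl_step_axioms.intro E S)
    show "ds j \<in> centralizer j"
      unfolding centralizer_def
    proof (intro CollectI conjI allI impI ds_closed j)
      fix i assume "i < j"
      with j have i: "i < n" "i \<noteq> j" by auto
      then show "ds j \<otimes>\<^bsub>D\<^esub> mult_op A (xs i) = mult_op A (xs i) \<otimes>\<^bsub>D\<^esub> ds j"
        unfolding ds_x[OF i(1)] x_ds
        by (intro restrict_ext) (simp add: dj xs_closed)
    qed
    have comm: "mult_op A r \<in> centralizer j" if "r \<in> carrier A" for r
      unfolding centralizer_def
      by (intro CollectI conjI allI impI mult_op_closed mult_op_commute that xs_closed)
        (use j in simp)
    then show "mult_op A (xs j) \<in> centralizer j" using xj .
    show "ds j \<otimes>\<^bsub>D\<^esub> mult_op A (xs j) = mult_op A (xs j) \<otimes>\<^bsub>D\<^esub> ds j \<oplus>\<^bsub>D\<^esub> \<one>\<^bsub>D\<^esub>"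
      unfolding ds_x[OF j] x_ds unfolding diff_op_ring_simps
      by (intro restrict_ext) (simp add: dj xj a_comm)
    show "\<exists>q\<in>centralizer j. q \<otimes>\<^bsub>D\<^esub> mult_op A (xs j) = mult_op A (xs j) \<otimes>\<^bsub>D\<^esub> q \<and> [Suc N] \<cdot>\<^bsub>D\<^esub> q = \<one>\<^bsub>D\<^esub>" for N
    proof -
      \<comment> \<open>Here \<open>c\<close> is \<open>1/(N+1)\<close> in \<open>A\<close>;
        multiplication by it commutes with every multiplication.\<close>
      obtain c where c: "c \<in> carrier A" "[Suc N] \<cdot> c = \<one>" using rational by blast
      have "[k] \<cdot>\<^bsub>D\<^esub> mult_op A c = mult_op A ([k] \<cdot> c)" for k :: nat
      proof (induction k)
        case 0
        show ?case by (auto simp: mult_op_def)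
      next
        case (Suc k)
        then show ?case using c(1) by (simp add: mult_op_add del: diff_op_ring_simps)
      qed
      then show ?thesis
        using comm[OF c(1)] mult_op_commute[OF c(1) xj] c(2) mult_op_one by metis
    qed
    fix P assume "P \<in> centralizer j"
    then have P: "P \<in> carrier D" unfolding centralizer_def by blast
    then show "\<exists>N. P \<in> diff_ops_of_order K A N" by simp
    show "P \<otimes>\<^bsub>D\<^esub> mult_op A (xs j) \<ominus>\<^bsub>D\<^esub> mult_op A (xs j) \<otimes>\<^bsub>D\<^esub> P \<in> diff_ops_of_order K A N"
      if "P \<in> diff_ops_of_order K A (Suc N)" for N
      using that xj unfolding commutator_op_eq[OF P xj] by simp
    assume "P \<in> diff_ops_of_order K A 0"
    then have "P \<otimes>\<^bsub>D\<^esub> mult_op A (xs j) \<ominus>\<^bsub>D\<^esub> mult_op A (xs j) \<otimes>\<^bsub>D\<^esub> P = \<zero>\<^bsub>D\<^esub>"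
      using xj unfolding commutator_op_eq[OF P xj] by simp
    then show "P \<otimes>\<^bsub>D\<^esub> mult_op A (xs j) = mult_op A (xs j) \<otimes>\<^bsub>D\<^esub> P"
      using D.r_right_minus_eq D.m_closed P mult_op_closed[OF xj] by blast
  qed
qed

text \<open>The set \<open>T\<close> of one step is the set \<open>S\<close> of the next. The
  subring property travels along in the induction because each step presupposes it.\<close>

lemma baer_on_centralizer:
  assumes E: "left_module D E" and baer: "baer_on (carrier D) D E"
  shows "j \<le> n \<Longrightarrow> subring (centralizer j) D \<and> baer_on (centralizer j) D E"
proof (induction j)
  case 0
  have "centralizer 0 = carrier D" by (simp add: centralizer_def del: diff_op_ring_simps)
  then show ?case using baer D.carrier_is_subring by metis
next
  case (Suc j)
  then interpret step: weyl_step D E "centralizer j" "ds j" "mult_op A (xs j)" "diff_ops_of_order K A"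
    using weyl_step_centralizer[OF E] by simp
  have "centralizer (Suc j) = step.T"
    unfolding step.T_def unfolding centralizer_def by (auto simp del: diff_op_ring_simps simp: less_Suc_eq)
  then show ?case using step.subring_T step.baer_on_T Suc by simp
qed

lemma centralizer_mult_op:
  assumes "P \<in> centralizer n"
  shows "P = mult_op A (P \<one>)"
proof (rule linear_endos_ext)
  have P: "P \<in> carrier D"
    and comm: "\<And>i. i < n \<Longrightarrow> P \<otimes>\<^bsub>D\<^esub> mult_op A (xs i) = mult_op A (xs i) \<otimes>\<^bsub>D\<^esub> P"
    using assms unfolding centralizer_def by blast+
  show lin: "P \<in> linear_endos K A" by (rule D_linear[OF P])
  show "mult_op A (P \<one>) \<in> linear_endos K A"
    by (rule mult_op_linear) (simp add: linear_endosD(1)[OF lin])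
  have xs: "P (xs i \<otimes> g) = xs i \<otimes> P g" if "i < n" "g \<in> carrier A" for i g
    using fun_cong[OF comm[OF that(1)], of g] that linear_endosD(1)[OF lin]
    by (simp add: compose_def mult_op_apply)
  show "P f = mult_op A (P \<one>) f" if "f \<in> carrier A" for f
    using xs_linear[OF lin xs that] that by (simp add: mult_op_apply)
qed

end

text \<open>An ideal of \<open>A\<close> together with its linear map is carried by
  \<open>mult_op A\<close> into \<open>centralizer n\<close>, the end of the chain, where Baer's
  property is known. The element \<open>e\<close> found there serves unchanged, since
  \<open>A\<close> acts on \<open>E\<close> through \<open>mult_op A\<close>.\<close>

theorem injective_restrict_scalars:
  fixes E :: "('r \<Rightarrow> 'r, 'e) module"
  assumes inj: "injective_module TYPE('r \<Rightarrow> 'r) D E"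
  shows "injective_module TYPE('m) A (restrict_scalars (mult_op A) E)"
proof (rule baer_on_imp_injective_module)
  have E: "left_module D E" using inj by (simp add: injective_module_def)
  interpret E: left_module D E by (rule E)
  have D: "ring D" by (rule E.R.ring_axioms)
  show "left_module A (restrict_scalars (mult_op A) E)"
    by (rule left_module_restrict_scalars[OF E ring_axioms])
      (use mult_op_closed mult_op_add mult_op_mult mult_op_one in blast)+
  have baer: "baer_on (centralizer n) D E"
    using baer_on_centralizer[OF D E injective_module_imp_baer_on[OF inj]] by simp
  show "baer_on (carrier A) A (restrict_scalars (mult_op A) E)"
    unfolding baer_on_def
  proof (intro allI impI, elim conjE)
    fix \<Gamma> assume G: "linear_graph (carrier A) (regular_module A) (restrict_scalars (mult_op A) E) \<Gamma>"
    note GD = linear_graphD[OF G, simplified]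
    define \<Delta> where "\<Delta> = (\<lambda>(a, y). (mult_op A a, y)) ` \<Gamma>"
    have \<Delta>I: "(P, y) \<in> \<Delta>" if "(a, y) \<in> \<Gamma>" "P = mult_op A a" for P a y
      using that by (force simp: \<Delta>_def)
    have \<Delta>E: "\<exists>a. (a, y) \<in> \<Gamma> \<and> P = mult_op A a" if "(P, y) \<in> \<Delta>" for P y
      using that by (auto simp: \<Delta>_def)
    have cent: "mult_op A a \<in> centralizer n" if "a \<in> carrier A" for a
      unfolding centralizer_def[OF D]
      by (intro CollectI conjI allI impI mult_op_closed mult_op_commute that xs_closed)
    have "linear_graph (centralizer n) (regular_module D) E \<Delta>"
      unfolding linear_graph_def
    proof (intro conjI allI impI ballI)
      show "\<Delta> \<subseteq> carrier (regular_module D) \<times> carrier E"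
      proof
        fix p assume "p \<in> \<Delta>"
        then obtain a y where "(a, y) \<in> \<Gamma>" "p = (mult_op A a, y)" using \<Delta>E by (cases p) blast
        then show "p \<in> carrier (regular_module D) \<times> carrier E"
          unfolding regular_module_simps using mult_op_closed[OF GD(1)] GD(2) by blast
      qed
      have "\<zero>\<^bsub>D\<^esub> = mult_op A \<zero>" by (auto simp: mult_op_def)
      then show "(\<zero>\<^bsub>regular_module D\<^esub>, \<zero>\<^bsub>E\<^esub>) \<in> \<Delta>"
        unfolding regular_module_simps by (rule \<Delta>I[OF GD(3)])
    next
      fix P y Q z assume "(P, y) \<in> \<Delta>" "(Q, z) \<in> \<Delta>"
      then obtain a b where *: "(a, y) \<in> \<Gamma>" "(b, z) \<in> \<Gamma>" "P = mult_op A a" "Q = mult_op A b"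
        using \<Delta>E by blast
      show "(P \<oplus>\<^bsub>regular_module D\<^esub> Q, y \<oplus>\<^bsub>E\<^esub> z) \<in> \<Delta>"
        unfolding regular_module_simps *
        by (rule \<Delta>I[OF GD(4)[OF *(1,2)]]) (use * GD(1) mult_op_add in simp)
    next
      fix P Q y assume P: "P \<in> centralizer n" and "(Q, y) \<in> \<Delta>"
      then obtain b where *: "(b, y) \<in> \<Gamma>" "Q = mult_op A b"
        using \<Delta>E by blast
      \<comment> \<open>Every scalar in \<open>centralizer n\<close> is the multiplication by its
        value at 1, so stability of \<open>\<Gamma>\<close> under \<open>A\<close> is what has to be
        used.\<close>
      define a where "a = P \<one>"
      have PD: "P \<in> carrier D" using P unfolding centralizer_def[OF D] by blast
      have a: "P = mult_op A a" "a \<in> carrier A"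
        unfolding a_def
        using centralizer_mult_op[OF D P] linear_endosD(1)[OF D_linear[OF PD]] by auto
      show "(P \<odot>\<^bsub>regular_module D\<^esub> Q, P \<odot>\<^bsub>E\<^esub> y) \<in> \<Delta>"
        unfolding regular_module_simps *(2) a(1)
        by (rule \<Delta>I[OF GD(5)[OF a(2) *(1)]]) (simp only: mult_op_mult a(2) GD(1)[OF *(1)])
    next
      fix y assume "(\<zero>\<^bsub>regular_module D\<^esub>, y) \<in> \<Delta>"
      then obtain a where "(a, y) \<in> \<Gamma>" "mult_op A a = \<zero>\<^bsub>D\<^esub>"
        using \<Delta>E[of "\<zero>\<^bsub>D\<^esub>" y] unfolding regular_module_simps by metis
      then have "(\<zero>, y) \<in> \<Gamma>" using mult_op_inj[OF GD(1)] by metis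
      then show "y = \<zero>\<^bsub>E\<^esub>" by (rule GD(6))
    qed
    moreover have "Domain \<Delta> \<subseteq> centralizer n" using cent GD(1) by (auto simp: \<Delta>_def)
    ultimately obtain e where e: "e \<in> carrier E" "\<And>P y. (P, y) \<in> \<Delta> \<Longrightarrow> y = P \<odot>\<^bsub>E\<^esub> e"
      by (rule baer_onE[OF baer]) blast
    then show "\<exists>e\<in>carrier (restrict_scalars (mult_op A) E). \<forall>a y. (a, y) \<in> \<Gamma> \<longrightarrow>
        y = a \<odot>\<^bsub>restrict_scalars (mult_op A) E\<^esub> e"
      using e(2)[OF \<Delta>I[OF _ refl]] e(1) unfolding restrict_scalars_simps by blast
  qed
qed

end

section \<open>Power series in several variables\<close>

text \<open>Both summands are dominated pointwise by \<open>\<gamma>\<close>: they are supported on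
  its keys and bounded by its largest value, which leaves finitely many functions.\<close>

lemma finite_antidiagonal: "finite {(\<alpha>, \<beta>). \<alpha> + \<beta> = (\<gamma> :: nat \<Rightarrow>\<^sub>0 nat)}"
proof -
  let ?le = "{\<alpha>. \<forall>i. Poly_Mapping.lookup \<alpha> i \<le> Poly_Mapping.lookup \<gamma> i}"
  let ?F = "{h. \<forall>i. (i \<in> Poly_Mapping.keys \<gamma> \<longrightarrow> h i \<in> {..Max (Poly_Mapping.lookup \<gamma> ` Poly_Mapping.keys \<gamma>)}) \<and>
    (i \<notin> Poly_Mapping.keys \<gamma> \<longrightarrow> h i = 0)}"
  have "finite ?F" by (rule finite_set_of_finite_funs) auto
  moreover have "Poly_Mapping.lookup ` ?le \<subseteq> ?F"
  proof clarify
    fix \<alpha> i assume le: "\<forall>i. Poly_Mapping.lookup \<alpha> i \<le> Poly_Mapping.lookup \<gamma> i"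
    show "(i \<in> Poly_Mapping.keys \<gamma> \<longrightarrow>
        Poly_Mapping.lookup \<alpha> i \<in> {..Max (Poly_Mapping.lookup \<gamma> ` Poly_Mapping.keys \<gamma>)}) \<and>
      (i \<notin> Poly_Mapping.keys \<gamma> \<longrightarrow> Poly_Mapping.lookup \<alpha> i = 0)"
    proof (intro conjI impI)
      assume "i \<in> Poly_Mapping.keys \<gamma>"
      then have "Poly_Mapping.lookup \<gamma> i \<le> Max (Poly_Mapping.lookup \<gamma> ` Poly_Mapping.keys \<gamma>)"
        by (intro Max_ge) auto
      then show "Poly_Mapping.lookup \<alpha> i \<in> {..Max (Poly_Mapping.lookup \<gamma> ` Poly_Mapping.keys \<gamma>)}"
        using le order_trans by auto
    next
      assume "i \<notin> Poly_Mapping.keys \<gamma>"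
      then show "Poly_Mapping.lookup \<alpha> i = 0" using le[rule_format, of i] by (simp add: in_keys_iff)
    qed
  qed
  ultimately have "finite (Poly_Mapping.lookup ` ?le)" by (rule finite_subset[rotated])
  then have "finite ?le"
    by (rule finite_imageD) (auto simp: inj_on_def intro: poly_mapping_eqI)
  moreover have "{(\<alpha>, \<beta>). \<alpha> + \<beta> = \<gamma>} \<subseteq> ?le \<times> ?le"
    by (auto simp: lookup_add)
  ultimately show ?thesis using finite_subset by blast
qed

section \<open>The Cauchy product of multivariate series\<close>

definition cauchy_prod ::
    "('k::comm_ring_1) mseries \<Rightarrow> 'k mseries \<Rightarrow> 'k mseries"
  where "cauchy_prod f g = (\<lambda>\<gamma>. \<Sum>(\<alpha>, \<beta>) | \<alpha> + \<beta> = \<gamma>. f \<alpha> * g \<beta>)"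

lemma cauchy_prod_commute: "cauchy_prod f g = cauchy_prod g f"
  unfolding cauchy_prod_def
  by (intro ext, rule sum.reindex_bij_witness[where i = prod.swap and j = prod.swap])
    (auto simp: ac_simps)

lemma cauchy_prod_assoc: "cauchy_prod (cauchy_prod f g) h = cauchy_prod f (cauchy_prod g h)"
proof
  fix \<gamma>
  let ?A = "\<lambda>\<gamma>. {(\<alpha>, \<beta>). \<alpha> + \<beta> = (\<gamma> :: nat \<Rightarrow>\<^sub>0 nat)}"
  have "cauchy_prod (cauchy_prod f g) h \<gamma> = (\<Sum>p\<in>?A \<gamma>. \<Sum>q\<in>?A (fst p). f (fst q) * g (snd q) * h (snd p))"
    by (simp add: cauchy_prod_def case_prod_beta sum_distrib_right)
  also have "\<dots> = (\<Sum>(p, q)\<in>(SIGMA p:?A \<gamma>. ?A (fst p)). f (fst q) * g (snd q) * h (snd p))"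
    by (rule sum.Sigma) (use finite_antidiagonal in auto)
  \<comment> \<open>Both double sums range over ordered triples of exponents with sum
    \<open>\<gamma>\<close>; the witnesses rebracket a triple.\<close>
  also have "\<dots> = (\<Sum>(p, q)\<in>(SIGMA p:?A \<gamma>. ?A (snd p)). f (fst p) * (g (fst q) * h (snd q)))"
    by (rule sum.reindex_bij_witness[where
          i = "\<lambda>(p, q). ((fst p + fst q, snd q), (fst p, fst q))" and
          j = "\<lambda>(p, q). ((fst q, snd q + snd p), (snd q, snd p))"])
      (auto simp: ac_simps)
  also have "\<dots> = (\<Sum>p\<in>?A \<gamma>. \<Sum>q\<in>?A (snd p). f (fst p) * (g (fst q) * h (snd q)))"
    by (rule sum.Sigma[symmetric]) (use finite_antidiagonal in auto)
  also have "\<dots> = cauchy_prod f (cauchy_prod g h) \<gamma>"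
    by (simp add: cauchy_prod_def case_prod_beta sum_distrib_left)
  finally show "cauchy_prod (cauchy_prod f g) h \<gamma> = cauchy_prod f (cauchy_prod g h) \<gamma>" .
qed

lemma cauchy_prod_add_left:
  "cauchy_prod (\<lambda>\<alpha>. f \<alpha> + g \<alpha>) h = (\<lambda>\<gamma>. cauchy_prod f h \<gamma> + cauchy_prod g h \<gamma>)"
  by (simp add: cauchy_prod_def case_prod_beta distrib_right sum.distrib)

lemma cauchy_prod_smult_left:
  "cauchy_prod (\<lambda>\<alpha>. c * f \<alpha>) g = (\<lambda>\<gamma>. c * cauchy_prod f g \<gamma>)"
  by (simp add: cauchy_prod_def case_prod_beta sum_distrib_left mult.assoc)

lemma cauchy_prod_one: "cauchy_prod (\<lambda>\<alpha>. if \<alpha> = 0 then 1 else 0) g = g"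
proof
  fix \<gamma>
  have "cauchy_prod (\<lambda>\<alpha>. if \<alpha> = 0 then 1 else 0) g \<gamma> =
      (\<Sum>(\<alpha>, \<beta>)\<in>{(0 :: nat \<Rightarrow>\<^sub>0 nat, \<gamma>)}. (if \<alpha> = 0 then 1 else 0) * g \<beta>)"
    unfolding cauchy_prod_def by (rule sum.mono_neutral_right) (use finite_antidiagonal in \<open>auto split: if_splits\<close>)
  then show "cauchy_prod (\<lambda>\<alpha>. if \<alpha> = 0 then 1 else 0) g \<gamma> = g \<gamma>" by simp
qed

definition eps :: "nat \<Rightarrow> nat \<Rightarrow>\<^sub>0 nat" where "eps i = Poly_Mapping.single i 1"

lemma lookup_eps [simp]: "Poly_Mapping.lookup (eps i) j = (if i = j then 1 else 0)"
  by (simp add: eps_def lookup_single when_def)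

lemma add_eps_diff: "0 < Poly_Mapping.lookup \<alpha> i \<Longrightarrow> (\<alpha> - eps i) + eps i = \<alpha>"
  by (rule poly_mapping_eqI) (auto simp: lookup_add lookup_minus)

text \<open>Only the pair \<open>(eps i, \<gamma> - eps i)\<close> contributes, and it adds up to
  \<open>\<gamma>\<close> exactly when the exponent of the variable in \<open>\<gamma>\<close> is
  positive. Subtraction being truncated, the case distinction is essential.\<close>

lemma cauchy_prod_var:
  "cauchy_prod (\<lambda>\<alpha>. if \<alpha> = eps i then 1 else 0) g =
    (\<lambda>\<gamma>. if Poly_Mapping.lookup \<gamma> i = 0 then 0 else g (\<gamma> - eps i))"
proof
  fix \<gamma>
  have "cauchy_prod (\<lambda>\<alpha>. if \<alpha> = eps i then 1 else 0) g \<gamma> =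
      (\<Sum>(\<alpha>, \<beta>)\<in>(if Poly_Mapping.lookup \<gamma> i = 0 then {} else {(eps i, \<gamma> - eps i)}).
        (if \<alpha> = eps i then 1 else 0) * g \<beta>)"
    unfolding cauchy_prod_def
    by (rule sum.mono_neutral_right)
      (use finite_antidiagonal in \<open>auto simp: add_eps_diff lookup_add add.commute[of "eps i"] split: if_splits\<close>)
  then show "cauchy_prod (\<lambda>\<alpha>. if \<alpha> = eps i then 1 else 0) g \<gamma> =
      (if Poly_Mapping.lookup \<gamma> i = 0 then 0 else g (\<gamma> - eps i))"
    by simp
qed

definition series_deriv :: "nat \<Rightarrow> ('k::comm_ring_1) mseries \<Rightarrow> 'k mseries" where
  "series_deriv i f = (\<lambda>\<alpha>. of_nat (Suc (Poly_Mapping.lookup \<alpha> i)) * f (\<alpha> + eps i))"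

text \<open>One half of the Leibniz rule. The weight kills the pairs with exponent 0 at
  \<open>i\<close>; in the others one unit of that exponent is removed from
  \<open>\<alpha>\<close>.\<close>

lemma sum_antidiagonal_shift:
  "(\<Sum>(\<alpha>, \<beta>) | \<alpha> + \<beta> = \<gamma> + eps i. of_nat (Poly_Mapping.lookup \<alpha> i) * f \<alpha> * g \<beta>) =
    cauchy_prod (series_deriv i f) g \<gamma>"
proof -
  let ?A = "\<lambda>\<gamma>. {(\<alpha>, \<beta>). \<alpha> + \<beta> = (\<gamma> :: nat \<Rightarrow>\<^sub>0 nat)}"
  have "(\<Sum>(\<alpha>, \<beta>)\<in>?A (\<gamma> + eps i). of_nat (Poly_Mapping.lookup \<alpha> i) * f \<alpha> * g \<beta>) =
      (\<Sum>(\<alpha>, \<beta>)\<in>{(\<alpha>, \<beta>) \<in> ?A (\<gamma> + eps i). 0 < Poly_Mapping.lookup \<alpha> i}.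
        of_nat (Poly_Mapping.lookup \<alpha> i) * f \<alpha> * g \<beta>)"
    by (rule sum.mono_neutral_right) (use finite_antidiagonal in \<open>auto intro!: Nat.gr0I\<close>)
  also have "\<dots> = (\<Sum>(\<alpha>, \<beta>)\<in>?A \<gamma>. of_nat (Suc (Poly_Mapping.lookup \<alpha> i)) * f (\<alpha> + eps i) * g \<beta>)"
  proof (rule sum.reindex_bij_witness[where
        i = "\<lambda>(\<alpha>, \<beta>). (\<alpha> + eps i, \<beta>)" and j = "\<lambda>(\<alpha>, \<beta>). (\<alpha> - eps i, \<beta>)"])
    fix p assume p: "p \<in> {(\<alpha>, \<beta>) \<in> ?A (\<gamma> + eps i). 0 < Poly_Mapping.lookup \<alpha> i}"
    then obtain \<alpha> \<beta> where *: "p = (\<alpha>, \<beta>)" "\<alpha> + \<beta> = \<gamma> + eps i" "0 < Poly_Mapping.lookup \<alpha> i" by auto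
    note ae = add_eps_diff[OF *(3)]
    show "(case case p of (\<alpha>, \<beta>) \<Rightarrow> (\<alpha> - eps i, \<beta>) of (\<alpha>, \<beta>) \<Rightarrow> (\<alpha> + eps i, \<beta>)) = p"
      using ae * by simp
    have "(\<alpha> - eps i + \<beta>) + eps i = (\<alpha> - eps i + eps i) + \<beta>" by (simp only: ac_simps)
    then have "(\<alpha> - eps i) + \<beta> = \<gamma>" unfolding ae *(2) by (rule add_right_imp_eq)
    then show "(case p of (\<alpha>, \<beta>) \<Rightarrow> (\<alpha> - eps i, \<beta>)) \<in> ?A \<gamma>" using * by simp
    have "Suc (Poly_Mapping.lookup (\<alpha> - eps i) i) = Poly_Mapping.lookup \<alpha> i"
      using *(3) by (simp add: lookup_minus)
    then show "(case case p of (\<alpha>, \<beta>) \<Rightarrow> (\<alpha> - eps i, \<beta>) of (\<alpha>, \<beta>) \<Rightarrow>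
        of_nat (Suc (Poly_Mapping.lookup \<alpha> i)) * f (\<alpha> + eps i) * g \<beta>) =
      (case p of (\<alpha>, \<beta>) \<Rightarrow> of_nat (Poly_Mapping.lookup \<alpha> i) * f \<alpha> * g \<beta>)"
      using * ae by (simp del: of_nat_Suc)
  qed (auto simp: lookup_add ac_simps)
  finally show ?thesis by (simp add: cauchy_prod_def series_deriv_def)
qed

text \<open>On the antidiagonal the weight at \<open>i\<close> is the sum of the weights of the two
  summands; each part is an instance of \<open>sum_antidiagonal_shift\<close>, the second one after
  exchanging the factors.\<close>

lemma series_deriv_cauchy_prod:
  "series_deriv i (cauchy_prod f g) =
    (\<lambda>\<gamma>. cauchy_prod (series_deriv i f) g \<gamma> + cauchy_prod f (series_deriv i g) \<gamma>)"
proof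
  fix \<gamma>
  let ?A = "{(\<alpha>, \<beta>). \<alpha> + \<beta> = \<gamma> + eps i}"
  have "series_deriv i (cauchy_prod f g) \<gamma> =
      (\<Sum>(\<alpha>, \<beta>)\<in>?A. of_nat (Poly_Mapping.lookup (\<gamma> + eps i) i) * (f \<alpha> * g \<beta>))"
    by (simp add: series_deriv_def cauchy_prod_def lookup_add sum_distrib_left case_prod_beta)
  also have "\<dots> = (\<Sum>(\<alpha>, \<beta>)\<in>?A. of_nat (Poly_Mapping.lookup \<alpha> i) * f \<alpha> * g \<beta> +
      of_nat (Poly_Mapping.lookup \<beta> i) * g \<beta> * f \<alpha>)"
  proof (rule sum.cong[OF refl], clarify)
    fix \<alpha> \<beta> assume "\<alpha> + \<beta> = \<gamma> + eps i"
    then have "Poly_Mapping.lookup (\<gamma> + eps i) i = Poly_Mapping.lookup \<alpha> i + Poly_Mapping.lookup \<beta> i"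
      by (metis lookup_add)
    then show "of_nat (Poly_Mapping.lookup (\<gamma> + eps i) i) * (f \<alpha> * g \<beta>) =
        of_nat (Poly_Mapping.lookup \<alpha> i) * f \<alpha> * g \<beta> + of_nat (Poly_Mapping.lookup \<beta> i) * g \<beta> * f \<alpha>"
      by (simp add: algebra_simps)
  qed
  also have "\<dots> = (\<Sum>(\<alpha>, \<beta>)\<in>?A. of_nat (Poly_Mapping.lookup \<alpha> i) * f \<alpha> * g \<beta>) +
      (\<Sum>(\<alpha>, \<beta>)\<in>?A. of_nat (Poly_Mapping.lookup \<beta> i) * g \<beta> * f \<alpha>)"
    by (simp add: sum.distrib case_prod_beta)
  also have "(\<Sum>(\<alpha>, \<beta>)\<in>?A. of_nat (Poly_Mapping.lookup \<beta> i) * g \<beta> * f \<alpha>) =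
      (\<Sum>(\<alpha>, \<beta>)\<in>?A. of_nat (Poly_Mapping.lookup \<alpha> i) * g \<alpha> * f \<beta>)"
    by (rule sum.reindex_bij_witness[where i = prod.swap and j = prod.swap]) (auto simp: ac_simps)
  finally show "series_deriv i (cauchy_prod f g) \<gamma> =
      cauchy_prod (series_deriv i f) g \<gamma> + cauchy_prod f (series_deriv i g) \<gamma>"
    unfolding sum_antidiagonal_shift by (simp add: cauchy_prod_commute)
qed

definition total_degree :: "nat \<Rightarrow> (nat \<Rightarrow>\<^sub>0 nat) \<Rightarrow> nat" where
  "total_degree n \<alpha> = (\<Sum>i<n. Poly_Mapping.lookup \<alpha> i)"

lemma total_degree_add: "total_degree n (\<alpha> + \<beta>) = total_degree n \<alpha> + total_degree n \<beta>"
  by (simp add: total_degree_def lookup_add sum.distrib)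

lemma total_degree_eps: "i < n \<Longrightarrow> total_degree n (eps i) = 1"
  by (simp add: total_degree_def)

text \<open>The coefficient map \<open>co\<close> identifies \<open>A\<close> with an algebra of power series, so that polynomials
  and series are treated alike. By \<open>co_shift\<close> and \<open>co_restrict\<close> one can write \<open>f = f|\<^bsub>x\<^sub>i=0\<^esub> + x\<^sub>i r\<close>
  within \<open>A\<close>.\<close>

locale coeff_algebra = cring A
  for A :: "('k::field_char_0, 'r) module" (structure) +
  fixes n :: nat and co :: "'r \<Rightarrow> 'k mseries"
  assumes co_inj: "inj_on co (carrier A)"
    and co_support: "f \<in> carrier A \<Longrightarrow> co f \<alpha> \<noteq> 0 \<Longrightarrow> Poly_Mapping.keys \<alpha> \<subseteq> {..<n}"
    and co_add: "f \<in> carrier A \<Longrightarrow> g \<in> carrier A \<Longrightarrow> co (f \<oplus> g) = (\<lambda>\<alpha>. co f \<alpha> + co g \<alpha>)"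
    and co_mult: "f \<in> carrier A \<Longrightarrow> g \<in> carrier A \<Longrightarrow> co (f \<otimes> g) = cauchy_prod (co f) (co g)"
    and co_one: "co \<one> = (\<lambda>\<alpha>. if \<alpha> = 0 then 1 else 0)"
    and smult_closed: "f \<in> carrier A \<Longrightarrow> c \<odot> f \<in> carrier A"
    and co_smult: "f \<in> carrier A \<Longrightarrow> co (c \<odot> f) = (\<lambda>\<alpha>. c * co f \<alpha>)"
    and co_var: "i < n \<Longrightarrow> (\<lambda>\<alpha>. if \<alpha> = eps i then 1 else 0) \<in> co ` carrier A"
    and co_deriv: "i < n \<Longrightarrow> f \<in> carrier A \<Longrightarrow> series_deriv i (co f) \<in> co ` carrier A"
    and co_shift: "i < n \<Longrightarrow> f \<in> carrier A \<Longrightarrow> (\<lambda>\<alpha>. co f (\<alpha> + eps i)) \<in> co ` carrier A"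
    and co_restrict: "i < n \<Longrightarrow> f \<in> carrier A \<Longrightarrow>
      (\<lambda>\<alpha>. if Poly_Mapping.lookup \<alpha> i = 0 then co f \<alpha> else 0) \<in> co ` carrier A"
begin

lemma co_eqI: "f \<in> carrier A \<Longrightarrow> g \<in> carrier A \<Longrightarrow> co f = co g \<Longrightarrow> f = g"
  using co_inj by (rule inj_onD)

lemma co_zero: "co \<zero> = (\<lambda>\<alpha>. 0)"
  using co_add[OF zero_closed zero_closed] by (auto simp: fun_eq_iff)

definition coinv :: "'k mseries \<Rightarrow> 'r" where "coinv = inv_into (carrier A) co"

lemma co_coinv: "h \<in> co ` carrier A \<Longrightarrow> co (coinv h) = h"
  unfolding coinv_def by (rule f_inv_into_f)

lemma coinv_closed: "h \<in> co ` carrier A \<Longrightarrow> coinv h \<in> carrier A"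
  unfolding coinv_def by (rule inv_into_into)

definition var :: "nat \<Rightarrow> 'r" where "var i = coinv (\<lambda>\<alpha>. if \<alpha> = eps i then 1 else 0)"

definition pderiv :: "nat \<Rightarrow> 'r \<Rightarrow> 'r"
  where "pderiv i = (\<lambda>f\<in>carrier A. coinv (series_deriv i (co f)))"

lemma var_closed: "i < n \<Longrightarrow> var i \<in> carrier A"
  unfolding var_def by (intro coinv_closed co_var)

lemma co_var_eq: "i < n \<Longrightarrow> co (var i) = (\<lambda>\<alpha>. if \<alpha> = eps i then 1 else 0)"
  unfolding var_def by (intro co_coinv co_var)

lemma co_var_mult: "i < n \<Longrightarrow> g \<in> carrier A \<Longrightarrow> co (var i \<otimes> g) =
    (\<lambda>\<gamma>. if Poly_Mapping.lookup \<gamma> i = 0 then 0 else co g (\<gamma> - eps i))"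
  by (simp add: co_mult var_closed co_var_eq cauchy_prod_var)

lemma pderiv_closed: "i < n \<Longrightarrow> f \<in> carrier A \<Longrightarrow> pderiv i f \<in> carrier A"
  unfolding pderiv_def using coinv_closed[OF co_deriv] by simp

lemma co_pderiv: "i < n \<Longrightarrow> f \<in> carrier A \<Longrightarrow> co (pderiv i f) = series_deriv i (co f)"
  unfolding pderiv_def using co_coinv[OF co_deriv] by simp

lemma split_variable:
  assumes i: "i < n" and f: "f \<in> carrier A"
  obtains f' r where "f' \<in> carrier A" "r \<in> carrier A" "f = f' \<oplus> var i \<otimes> r"
    "co f' = (\<lambda>\<alpha>. if Poly_Mapping.lookup \<alpha> i = 0 then co f \<alpha> else 0)"
proof -
  define f' where "f' = coinv (\<lambda>\<alpha>. if Poly_Mapping.lookup \<alpha> i = 0 then co f \<alpha> else 0)"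
  define r where "r = coinv (\<lambda>\<alpha>. co f (\<alpha> + eps i))"
  have f': "f' \<in> carrier A" and r: "r \<in> carrier A"
    unfolding f'_def r_def by (intro coinv_closed co_restrict co_shift i f)+
  have co_f': "co f' = (\<lambda>\<alpha>. if Poly_Mapping.lookup \<alpha> i = 0 then co f \<alpha> else 0)"
    unfolding f'_def by (rule co_coinv[OF co_restrict[OF i f]])
  have co_r: "co r = (\<lambda>\<alpha>. co f (\<alpha> + eps i))"
    unfolding r_def by (rule co_coinv[OF co_shift[OF i f]])
  have "f = f' \<oplus> var i \<otimes> r"
  proof (rule co_eqI)
    show "co f = co (f' \<oplus> var i \<otimes> r)"
      using f' r var_closed[OF i]
      by (auto simp: co_add co_var_mult[OF i r] co_f' co_r add_eps_diff)
  qed (use f f' r var_closed[OF i] in auto)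
  then show ?thesis using that f' r co_f' by blast
qed

text \<open>The difference of the two sides lies in every power of the ideal generated by the variables:
  write \<open>f = c + \<Sum>i<n. x\<^sub>i r\<^sub>i\<close>, splitting off one variable at a time, and recurse on the \<open>r\<^sub>i\<close>.\<close>

lemma var_linear:
  assumes P: "P \<in> linear_endos (ring_of_type_algebra :: 'k ring) A"
    and comm: "\<And>i g. i < n \<Longrightarrow> g \<in> carrier A \<Longrightarrow> P (var i \<otimes> g) = var i \<otimes> P g"
    and f: "f \<in> carrier A"
  shows "P f = P \<one> \<otimes> f"
proof -
  have Pc: "P g \<in> carrier A" and Padd: "h \<in> carrier A \<Longrightarrow> P (g \<oplus> h) = P g \<oplus> P h"
    and Psm: "P (c \<odot> g) = c \<odot> P g" if "g \<in> carrier A" for g h c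
    using P that by (auto simp: linear_endos_def ring_of_type_algebra_def)
  have P1: "P \<one> \<in> carrier A" by (rule Pc) simp
  \<comment> \<open>The bound \<open>N\<close> on the degree stands for working modulo the
    \<open>N\<close>-th power of the ideal of the variables. The element \<open>f\<close> is
    arbitrary, because the recursion moves on to the quotients by variables.\<close>
  have "co (P f) \<alpha> = co (P \<one> \<otimes> f) \<alpha>" if "total_degree n \<alpha> < N" "f \<in> carrier A" for N f \<alpha>
    using that
  proof (induction N arbitrary: f \<alpha>)
    case 0
    then show ?case by simp
  next
    case (Suc N)
    \<comment> \<open>Inner downward induction on the number \<open>j\<close> of initial variables
      absent from \<open>g\<close>: at \<open>j = n\<close> it is a constant, covered by linearity
      over the field, and at \<open>j = 0\<close> it is arbitrary.\<close>
    have "co (P g) \<alpha> = co (P \<one> \<otimes> g) \<alpha>"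
      if "j \<le> n" "g \<in> carrier A" "\<And>\<beta> i. co g \<beta> \<noteq> 0 \<Longrightarrow> i < j \<Longrightarrow> Poly_Mapping.lookup \<beta> i = 0" for j g
      using that
    proof (induction j arbitrary: g rule: inc_induct)
      case base
      have supp: "\<beta> = 0" if "co g \<beta> \<noteq> 0" for \<beta>
      proof (rule poly_mapping_eqI)
        fix i
        show "Poly_Mapping.lookup \<beta> i = Poly_Mapping.lookup 0 i"
          using base(2)[OF that, of i] co_support[OF base(1) that] by (force simp: in_keys_iff)
      qed
      have "g = co g 0 \<odot> \<one>"
      proof (rule co_eqI)
        show "co g = co (co g 0 \<odot> \<one>)"
          using supp by (auto simp: co_smult co_one fun_eq_iff)
      qed (use base smult_closed in auto)
      then have g: "co g = (\<lambda>\<alpha>. co g 0 * (if \<alpha> = 0 then 1 else 0))" and "P g = co g 0 \<odot> P \<one>"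
        using co_smult[OF one_closed, of "co g 0"] Psm[OF one_closed, of "co g 0"]
        by (simp_all add: co_one)
      then have "co (P g) = (\<lambda>\<alpha>. co g 0 * co (P \<one>) \<alpha>)" by (simp add: co_smult P1)
      moreover have "co (P \<one> \<otimes> g) = cauchy_prod (co g) (co (P \<one>))"
        using base(1) P1 by (simp add: co_mult cauchy_prod_commute)
      moreover have "cauchy_prod (co g) (co (P \<one>)) = (\<lambda>\<alpha>. co g 0 * co (P \<one>) \<alpha>)"
        by (subst g) (simp only: cauchy_prod_smult_left cauchy_prod_one)
      ultimately show ?case by simp
    next
      case (step j)
      then have j: "j < n" by simp
      obtain g' r where *: "g' \<in> carrier A" "r \<in> carrier A" "g = g' \<oplus> var j \<otimes> r"
        "co g' = (\<lambda>\<alpha>. if Poly_Mapping.lookup \<alpha> j = 0 then co g \<alpha> else 0)"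
        using split_variable[OF j step.prems(1)] by blast
      note [simp] = *(1,2) var_closed[OF j] P1
      \<comment> \<open>Setting variable \<open>j\<close> to zero leaves \<open>g'\<close> free of
        one more variable, so the inner hypothesis applies.\<close>
      have "co (P g') \<alpha> = co (P \<one> \<otimes> g') \<alpha>"
        by (rule step.IH) (use *(4) step.prems(2) in \<open>auto simp: less_Suc_eq split: if_splits\<close>)
      \<comment> \<open>The coefficient at \<open>\<alpha>\<close> of a multiple of the variable is
        a coefficient of the cofactor in degree one less, where the outer hypothesis applies to
        \<open>r\<close>.\<close>
      moreover have "co (var j \<otimes> P r) \<alpha> = co (var j \<otimes> (P \<one> \<otimes> r)) \<alpha>"
      proof (cases "Poly_Mapping.lookup \<alpha> j = 0")
        case True
        then show ?thesis by (simp add: co_var_mult j Pc)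
      next
        case False
        then have "total_degree n \<alpha> = total_degree n (\<alpha> - eps j) + 1"
          using total_degree_add[of n "\<alpha> - eps j" "eps j"] add_eps_diff[of \<alpha> j] j
          by (simp add: total_degree_eps)
        then have "co (P r) (\<alpha> - eps j) = co (P \<one> \<otimes> r) (\<alpha> - eps j)"
          using Suc.IH Suc.prems(1) by simp
        then show ?thesis using False by (simp add: co_var_mult j Pc)
      qed
      moreover have "P g = P g' \<oplus> var j \<otimes> P r"
        by (simp add: *(3) Padd comm j)
      moreover have "P \<one> \<otimes> g = P \<one> \<otimes> g' \<oplus> var j \<otimes> (P \<one> \<otimes> r)"
        by (simp add: *(3) r_distr m_lcomm)
      ultimately show ?case by (simp add: co_add Pc)
    qed
    from this[of 0 f] show ?case using Suc.prems by simp
  qed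
  then have "co (P f) = co (P \<one> \<otimes> f)" using f by blast
  then show ?thesis by (intro co_eqI) (simp_all add: Pc f)
qed

text \<open>The algebraic identities are compared on coefficients and pulled back by injectivity of
  \<open>co\<close>. Characteristic zero enters through the scalar \<open>1/(N+1)\<close>.\<close>

lemma weyl_algebra_pderiv: "weyl_algebra (ring_of_type_algebra :: 'k ring) A n var pderiv"
proof (intro weyl_algebra.intro weyl_algebra_axioms.intro is_cring)
  show "(c \<odot> f) \<otimes> g = c \<odot> (f \<otimes> g)" if "f \<in> carrier A" "g \<in> carrier A" for c f g
    by (rule co_eqI) (use that in \<open>simp_all add: smult_closed co_mult co_smult cauchy_prod_smult_left\<close>)
  show "pderiv i \<in> linear_endos (ring_of_type_algebra :: 'k ring) A" if i: "i < n" for i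
    unfolding linear_endos_def
  proof (intro CollectI conjI ballI)
    show "pderiv i \<in> carrier A \<rightarrow>\<^sub>E carrier A"
      using pderiv_closed[OF i] by (auto simp: PiE_def pderiv_def)
    show "pderiv i (f \<oplus> g) = pderiv i f \<oplus> pderiv i g" if "f \<in> carrier A" "g \<in> carrier A" for f g
      by (rule co_eqI)
        (use that i in \<open>simp_all add: pderiv_closed co_pderiv co_add series_deriv_def distrib_left del: of_nat_Suc\<close>)
    show "pderiv i (c \<odot> f) = c \<odot> pderiv i f" if "f \<in> carrier A" for c f
      by (rule co_eqI)
        (use that i in \<open>simp_all add: pderiv_closed co_pderiv co_smult smult_closed series_deriv_def mult.left_commute del: of_nat_Suc\<close>)
  qed
  show "pderiv i (f \<otimes> g) = pderiv i f \<otimes> g \<oplus> f \<otimes> pderiv i g"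
    if "i < n" "f \<in> carrier A" "g \<in> carrier A" for i f g
    by (rule co_eqI)
      (use that in \<open>simp_all add: pderiv_closed co_pderiv co_add co_mult series_deriv_cauchy_prod\<close>)
  show "pderiv i (var j) = (if i = j then \<one> else \<zero>)" if ij: "i < n" "j < n" for i j
  proof (rule co_eqI)
    have "\<alpha> + eps i \<noteq> eps j" if "i \<noteq> j" for \<alpha>
    proof
      assume "\<alpha> + eps i = eps j"
      then have "Poly_Mapping.lookup (\<alpha> + eps i) i = Poly_Mapping.lookup (eps j) i" by simp
      then show False using that by (simp add: lookup_add)
    qed
    moreover have "(\<alpha> + eps j = eps j) = (\<alpha> = 0)" for \<alpha> by simp
    ultimately show "co (pderiv i (var j)) = co (if i = j then \<one> else \<zero>)"
      using ij by (auto simp: co_pderiv var_closed co_one co_zero co_var_eq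
          series_deriv_def fun_eq_iff simp del: of_nat_Suc add_cancel_right_right)
  qed (use ij in \<open>auto simp: pderiv_closed var_closed\<close>)
  show "\<exists>c\<in>carrier A. [Suc N] \<cdot> c = \<one>" for N
  proof
    let ?c = "(1 / of_nat (Suc N)) \<odot> \<one>"
    show c: "?c \<in> carrier A" by (simp add: smult_closed)
    have "co ([k] \<cdot> ?c) = (\<lambda>\<alpha>. of_nat k * co ?c \<alpha>)" for k :: nat
      by (induction k) (use c in \<open>simp_all add: co_zero co_add distrib_right add.commute del: of_nat_Suc add: of_nat_Suc\<close>)
    then have "co ([Suc N] \<cdot> ?c) = co \<one>"
      by (auto simp: co_smult co_one fun_eq_iff simp del: of_nat_Suc add.nat_pow_Suc)
    then show "[Suc N] \<cdot> ?c = \<one>"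
      by (intro co_eqI) (use c in simp_all)
  qed
qed (use smult_closed var_closed var_linear in auto)

theorem injective_restrict_scalars:
  fixes E :: "('r \<Rightarrow> 'r, 'e) module"
  assumes "injective_module TYPE('r \<Rightarrow> 'r) (diff_op_ring (ring_of_type_algebra :: 'k ring) A) E"
  shows "injective_module TYPE('m) A (restrict_scalars (mult_op A) E)"
  using weyl_algebra.injective_restrict_scalars[OF weyl_algebra_pderiv assms] .

end

section \<open>The three algebras\<close>

lemma poly_algebra_simps [simp]:
  "carrier (poly_algebra n) = {p. \<forall>\<alpha>\<in>Poly_Mapping.keys p. Poly_Mapping.keys \<alpha> \<subseteq> {..<n}}"
  "p \<otimes>\<^bsub>poly_algebra n\<^esub> q = p * q" "\<one>\<^bsub>poly_algebra n\<^esub> = 1" "\<zero>\<^bsub>poly_algebra n\<^esub> = 0"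
  "p \<oplus>\<^bsub>poly_algebra n\<^esub> q = p + q"
  "c \<odot>\<^bsub>poly_algebra n\<^esub> p = Poly_Mapping.single 0 c * p"
  by (simp_all add: poly_algebra_def)

lemma poly_mult_closed:
  assumes "p \<in> carrier (poly_algebra n)" "q \<in> carrier (poly_algebra n)"
  shows "p * q \<in> carrier (poly_algebra n)"
  unfolding poly_algebra_simps
proof (intro CollectI ballI)
  fix \<gamma> assume "\<gamma> \<in> Poly_Mapping.keys (p * q)"
  then obtain \<alpha> \<beta> where *: "\<gamma> = \<alpha> + \<beta>" "\<alpha> \<in> Poly_Mapping.keys p" "\<beta> \<in> Poly_Mapping.keys q"
    using keys_mult[of p q] by blast
  then have "Poly_Mapping.keys \<alpha> \<subseteq> {..<n}" "Poly_Mapping.keys \<beta> \<subseteq> {..<n}"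
    using assms unfolding poly_algebra_simps by blast+
  then show "Poly_Mapping.keys \<gamma> \<subseteq> {..<n}"
    using keys_add[of \<alpha> \<beta>] unfolding *(1) by blast
qed

lemma poly_add_closed:
  assumes "p \<in> carrier (poly_algebra n)" "q \<in> carrier (poly_algebra n)"
  shows "p + q \<in> carrier (poly_algebra n)"
  using assms keys_add[of p q] unfolding poly_algebra_simps by blast

lemma poly_single_closed: "Poly_Mapping.single 0 c \<in> carrier (poly_algebra n)"
  by simp

lemma cring_poly_algebra: "cring (poly_algebra n :: ('k::field, 'k mpoly) module)"
proof (rule cringI)
  let ?A = "poly_algebra n :: ('k, 'k mpoly) module"
  note closed = poly_mult_closed[simplified] poly_add_closed[simplified]
  show "abelian_group ?A"
  proof (rule abelian_groupI)
    show "\<exists>q\<in>carrier ?A. q \<oplus>\<^bsub>?A\<^esub> p = \<zero>\<^bsub>?A\<^esub>" if "p \<in> carrier ?A" for p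
      by (rule bexI[of _ "- p"]) (use that in \<open>simp_all add: in_keys_iff\<close>)
  qed (use closed in \<open>simp_all add: ac_simps\<close>)
  show "comm_monoid ?A"
    by (rule comm_monoidI) (use closed in \<open>simp_all add: ac_simps\<close>)
qed (simp add: distrib_right)

text \<open>The product of \<open>poly_mapping\<close> is a sum over all pairs of exponents guarded
  by \<open>when\<close>; the guard confines its support to the finite antidiagonal.\<close>

lemma lookup_mult_cauchy_prod:
  "Poly_Mapping.lookup (p * q) = cauchy_prod (Poly_Mapping.lookup p) (Poly_Mapping.lookup q)"
proof
  fix \<gamma>
  let ?f = "\<lambda>(\<alpha>, \<beta>). Poly_Mapping.lookup p \<alpha> * Poly_Mapping.lookup q \<beta> when \<gamma> = \<alpha> + \<beta>"
  have "Poly_Mapping.lookup (p * q) \<gamma> = Sum_any ?f"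
    by (simp add: times_poly_mapping.rep_eq prod_fun_unfold_prod)
  also have "\<dots> = sum ?f {(\<alpha>, \<beta>). \<alpha> + \<beta> = \<gamma>}"
    by (rule Sum_any.expand_superset) (use finite_antidiagonal in \<open>auto simp: when_def split: if_splits\<close>)
  also have "\<dots> = cauchy_prod (Poly_Mapping.lookup p) (Poly_Mapping.lookup q) \<gamma>"
    unfolding cauchy_prod_def by (rule sum.cong) auto
  finally show "Poly_Mapping.lookup (p * q) \<gamma> =
    cauchy_prod (Poly_Mapping.lookup p) (Poly_Mapping.lookup q) \<gamma>" .
qed

lemma lookup_image_poly_algebra:
  assumes "finite {\<alpha>. h \<alpha> \<noteq> 0}" "\<And>\<alpha>. h \<alpha> \<noteq> 0 \<Longrightarrow> Poly_Mapping.keys \<alpha> \<subseteq> {..<n}"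
  shows "h \<in> Poly_Mapping.lookup ` carrier (poly_algebra n)"
proof (rule image_eqI)
  show "h = Poly_Mapping.lookup (Abs_poly_mapping h)" using assms(1) by simp
  show "Abs_poly_mapping h \<in> carrier (poly_algebra n)"
    using assms by (auto simp: in_keys_iff)
qed

lemma keys_add_eps: "Poly_Mapping.keys (\<alpha> + eps i) = insert i (Poly_Mapping.keys \<alpha>)"
  by (auto simp: in_keys_iff lookup_add split: if_splits)

lemma keys_eps: "Poly_Mapping.keys (eps i) = {i}"
  by (auto simp: in_keys_iff split: if_splits)

lemma inj_add_eps: "inj (\<lambda>\<alpha>. \<alpha> + eps i)"
  by (rule injI) simp

lemma coeff_algebra_poly:
  "coeff_algebra (poly_algebra n :: ('k::field_char_0, 'k mpoly) module) n Poly_Mapping.lookup"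
proof (intro coeff_algebra.intro coeff_algebra_axioms.intro cring_poly_algebra)
  let ?A = "poly_algebra n :: ('k, 'k mpoly) module"
  show "inj_on Poly_Mapping.lookup (carrier ?A)"
    by (rule inj_onI) (simp add: poly_mapping_eqI)
  show "Poly_Mapping.keys \<alpha> \<subseteq> {..<n}" if "f \<in> carrier ?A" "Poly_Mapping.lookup f \<alpha> \<noteq> 0" for f \<alpha>
    using that by (simp add: in_keys_iff)
  show "Poly_Mapping.lookup (c \<odot>\<^bsub>?A\<^esub> f) = (\<lambda>\<alpha>. c * Poly_Mapping.lookup f \<alpha>)" for c f
  proof -
    have "Poly_Mapping.lookup (Poly_Mapping.single (0 :: nat \<Rightarrow>\<^sub>0 nat) c) = (\<lambda>\<alpha>. c * (if \<alpha> = 0 then 1 else 0))"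
      by (auto simp: lookup_single when_def)
    then show ?thesis
      by (simp only: poly_algebra_simps lookup_mult_cauchy_prod cauchy_prod_smult_left cauchy_prod_one)
  qed
  show "c \<odot>\<^bsub>?A\<^esub> f \<in> carrier ?A" if "f \<in> carrier ?A" for c f
    unfolding poly_algebra_simps(6) by (rule poly_mult_closed[OF poly_single_closed that])
  show "(\<lambda>\<alpha>. if \<alpha> = eps i then 1 else 0) \<in> Poly_Mapping.lookup ` carrier ?A" if "i < n" for i
    by (rule lookup_image_poly_algebra) (use that in \<open>auto simp: keys_eps split: if_splits\<close>)
  fix i f assume i: "i < n" and f: "f \<in> carrier ?A"
  have fin: "finite {\<alpha>. Poly_Mapping.lookup f (\<alpha> + eps i) \<noteq> 0}"
    using finite_vimageI[OF finite_lookup[of f] inj_add_eps[of i]] by (simp add: vimage_def)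
  have supp: "Poly_Mapping.keys \<alpha> \<subseteq> {..<n}" if "Poly_Mapping.lookup f (\<alpha> + eps i) \<noteq> 0" for \<alpha>
    using f that keys_add_eps[of \<alpha> i] by (auto simp: in_keys_iff[symmetric])
  show "(\<lambda>\<alpha>. Poly_Mapping.lookup f (\<alpha> + eps i)) \<in> Poly_Mapping.lookup ` carrier ?A"
    by (rule lookup_image_poly_algebra[OF fin supp])
  show "series_deriv i (Poly_Mapping.lookup f) \<in> Poly_Mapping.lookup ` carrier ?A"
    by (rule lookup_image_poly_algebra)
      (use fin supp in \<open>auto simp: series_deriv_def simp del: of_nat_Suc\<close>)
  have sub: "{\<alpha>. (if Poly_Mapping.lookup \<alpha> i = 0 then Poly_Mapping.lookup f \<alpha> else 0) \<noteq> 0}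
      \<subseteq> {\<alpha>. Poly_Mapping.lookup f \<alpha> \<noteq> 0}"
    by auto
  show "(\<lambda>\<alpha>. if Poly_Mapping.lookup \<alpha> i = 0 then Poly_Mapping.lookup f \<alpha> else 0)
      \<in> Poly_Mapping.lookup ` carrier ?A"
    by (rule lookup_image_poly_algebra[OF finite_subset[OF sub finite_lookup]])
      (use f in \<open>auto simp: in_keys_iff split: if_splits\<close>)
qed (simp_all add: lookup_add lookup_mult_cauchy_prod lookup_one when_def fun_eq_iff)

section \<open>Formal power series and their subalgebras\<close>

lemma series_algebra_simps [simp]:
  "carrier (series_algebra n) = {f. \<forall>\<alpha>. f \<alpha> \<noteq> 0 \<longrightarrow> Poly_Mapping.keys \<alpha> \<subseteq> {..<n}}"
  "f \<otimes>\<^bsub>series_algebra n\<^esub> g = cauchy_prod f g"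
  "\<one>\<^bsub>series_algebra n\<^esub> = (\<lambda>\<alpha>. if \<alpha> = 0 then 1 else 0)" "\<zero>\<^bsub>series_algebra n\<^esub> = (\<lambda>\<alpha>. 0)"
  "f \<oplus>\<^bsub>series_algebra n\<^esub> g = (\<lambda>\<alpha>. f \<alpha> + g \<alpha>)"
  "c \<odot>\<^bsub>series_algebra n\<^esub> f = (\<lambda>\<alpha>. c * f \<alpha>)"
  by (simp_all add: series_algebra_def cauchy_prod_def)

lemma cauchy_prod_nonzeroE:
  assumes "cauchy_prod f g \<gamma> \<noteq> 0"
  obtains \<alpha> \<beta> where "\<alpha> + \<beta> = \<gamma>" "f \<alpha> \<noteq> 0" "g \<beta> \<noteq> 0"
proof -
  obtain p where "p \<in> {(\<alpha>, \<beta>). \<alpha> + \<beta> = \<gamma>}" "(case p of (\<alpha>, \<beta>) \<Rightarrow> f \<alpha> * g \<beta>) \<noteq> 0"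
    using assms unfolding cauchy_prod_def by (rule sum.not_neutral_contains_not_neutral)
  then show ?thesis using that[of "fst p" "snd p"] mult_not_zero by (auto simp: case_prod_beta)
qed

lemma series_mult_closed:
  assumes "f \<in> carrier (series_algebra n)" "g \<in> carrier (series_algebra n)"
  shows "cauchy_prod f g \<in> carrier (series_algebra n)"
proof -
  have "Poly_Mapping.keys \<gamma> \<subseteq> {..<n}" if nz: "cauchy_prod f g \<gamma> \<noteq> 0" for \<gamma>
  proof -
    obtain \<alpha> \<beta> where *: "\<alpha> + \<beta> = \<gamma>" "f \<alpha> \<noteq> 0" "g \<beta> \<noteq> 0"
      by (rule cauchy_prod_nonzeroE[OF nz])
    then have "Poly_Mapping.keys \<alpha> \<subseteq> {..<n}" "Poly_Mapping.keys \<beta> \<subseteq> {..<n}"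
      using assms unfolding series_algebra_simps by blast+
    then show ?thesis
      using keys_add[of \<alpha> \<beta>] unfolding *(1) by blast
  qed
  then show ?thesis by simp
qed

text \<open>Serves the formal and the convergent case at once. The ring identities hold for all
  series, so each case reduces to closure properties of \<open>C\<close>; additive inverses come
  from the scalar -1.\<close>

lemma coeff_algebra_subalgebra:
  fixes n :: nat and C :: "('k::field_char_0) mseries set"
  defines "A \<equiv> (series_algebra n)\<lparr>carrier := C\<rparr>"
  assumes sub: "C \<subseteq> carrier (series_algebra n)"
    and one: "(\<lambda>\<alpha>. if \<alpha> = 0 then 1 else 0) \<in> C"
    and add: "\<And>f g. f \<in> C \<Longrightarrow> g \<in> C \<Longrightarrow> (\<lambda>\<alpha>. f \<alpha> + g \<alpha>) \<in> C"
    and mult: "\<And>f g. f \<in> C \<Longrightarrow> g \<in> C \<Longrightarrow> cauchy_prod f g \<in> C"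
    and smult: "\<And>c f. f \<in> C \<Longrightarrow> (\<lambda>\<alpha>. c * f \<alpha>) \<in> C"
    and var: "\<And>i. i < n \<Longrightarrow> (\<lambda>\<alpha>. if \<alpha> = eps i then 1 else 0) \<in> C"
    and deriv: "\<And>i f. i < n \<Longrightarrow> f \<in> C \<Longrightarrow> series_deriv i f \<in> C"
    and shift: "\<And>i f. i < n \<Longrightarrow> f \<in> C \<Longrightarrow> (\<lambda>\<alpha>. f (\<alpha> + eps i)) \<in> C"
    and restrict: "\<And>i f. i < n \<Longrightarrow> f \<in> C \<Longrightarrow>
      (\<lambda>\<alpha>. if Poly_Mapping.lookup \<alpha> i = 0 then f \<alpha> else 0) \<in> C"
  shows "coeff_algebra A n (\<lambda>f. f)"
proof -
  have A_simps: "carrier A = C" "\<And>f g. f \<otimes>\<^bsub>A\<^esub> g = cauchy_prod f g"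
    "\<one>\<^bsub>A\<^esub> = (\<lambda>\<alpha>. if \<alpha> = 0 then 1 else 0)" "\<zero>\<^bsub>A\<^esub> = (\<lambda>\<alpha>. 0)"
    "\<And>f g. f \<oplus>\<^bsub>A\<^esub> g = (\<lambda>\<alpha>. f \<alpha> + g \<alpha>)" "\<And>c f. c \<odot>\<^bsub>A\<^esub> f = (\<lambda>\<alpha>. c * f \<alpha>)"
    by (simp_all add: A_def series_algebra_def cauchy_prod_def)
  have zero: "(\<lambda>\<alpha>. 0) \<in> C" using smult[OF one, of 0] by simp
  have "abelian_group A"
  proof (rule abelian_groupI)
    show "\<exists>g\<in>carrier A. g \<oplus>\<^bsub>A\<^esub> f = \<zero>\<^bsub>A\<^esub>" if "f \<in> carrier A" for f
      using smult[of f "-1"] that by (intro bexI[of _ "\<lambda>\<alpha>. - 1 * f \<alpha>"]) (auto simp: A_simps)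
  qed (use add zero in \<open>simp_all add: A_simps ac_simps\<close>)
  moreover have "comm_monoid A"
  proof (rule comm_monoidI)
    show "f \<otimes>\<^bsub>A\<^esub> g \<otimes>\<^bsub>A\<^esub> h = f \<otimes>\<^bsub>A\<^esub> (g \<otimes>\<^bsub>A\<^esub> h)" for f g h
      by (simp only: A_simps cauchy_prod_assoc)
    show "f \<otimes>\<^bsub>A\<^esub> g = g \<otimes>\<^bsub>A\<^esub> f" for f g
      unfolding A_simps by (rule cauchy_prod_commute)
  qed (use mult one in \<open>simp_all add: A_simps cauchy_prod_one\<close>)
  ultimately have "cring A"
    by (rule cringI) (simp add: A_simps cauchy_prod_add_left)
  then show ?thesis
    by (intro coeff_algebra.intro coeff_algebra_axioms.intro)
      (use sub smult var deriv shift restrict in \<open>auto simp: A_simps\<close>)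
qed

lemma coeff_algebra_series:
  "coeff_algebra (series_algebra n :: ('k::field_char_0, 'k mseries) module) n (\<lambda>f. f)"
proof -
  have "coeff_algebra ((series_algebra n)\<lparr>carrier := carrier (series_algebra n :: ('k, 'k mseries) module)\<rparr>) n (\<lambda>f. f)"
  proof (rule coeff_algebra_subalgebra[OF order_refl])
    show "cauchy_prod f g \<in> carrier (series_algebra n)"
      if "f \<in> carrier (series_algebra n)" "g \<in> carrier (series_algebra n)" for f g :: "'k mseries"
      by (rule series_mult_closed[OF that])
    fix i and f g :: "'k mseries"
    assume f: "f \<in> carrier (series_algebra n)"
    have supp: "Poly_Mapping.keys \<alpha> \<subseteq> {..<n}" if "f (\<alpha> + eps i) \<noteq> 0" for \<alpha>
    proof -
      have "Poly_Mapping.keys (\<alpha> + eps i) \<subseteq> {..<n}"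
        using f that unfolding series_algebra_simps by blast
      then show ?thesis unfolding keys_add_eps by blast
    qed
    then show "(\<lambda>\<alpha>. f (\<alpha> + eps i)) \<in> carrier (series_algebra n)"
      unfolding series_algebra_simps by blast
    show "series_deriv i f \<in> carrier (series_algebra n)"
      using supp mult_not_zero unfolding series_algebra_simps series_deriv_def by blast
    assume g: "g \<in> carrier (series_algebra n)"
    have "f \<alpha> \<noteq> 0 \<or> g \<alpha> \<noteq> 0" if "f \<alpha> + g \<alpha> \<noteq> 0" for \<alpha>
      using that by auto
    then show "(\<lambda>\<alpha>. f \<alpha> + g \<alpha>) \<in> carrier (series_algebra n)"
      using f g unfolding series_algebra_simps by blast
  qed (auto simp: keys_eps)
  then show ?thesis by (simp del: series_algebra_simps)
qed

section \<open>Convergent power series\<close>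

text \<open>The weighted \<open>l1\<close> norm of the coefficients at the polyradius
  \<open>(r, ..., r)\<close> is at most \<open>B\<close>. Finite partial sums make closure
  properties a matter of finite inequalities.\<close>

definition geometrically_bounded :: "nat \<Rightarrow> complex mseries \<Rightarrow> real \<Rightarrow> real \<Rightarrow> bool" where
  "geometrically_bounded n f r B \<longleftrightarrow>
    0 < r \<and> (\<forall>Y. finite Y \<longrightarrow> (\<Sum>\<alpha>\<in>Y. norm (f \<alpha>) * r ^ total_degree n \<alpha>) \<le> B)"

text \<open>Summability of complex families is absolute, so convergence on a polydisc can be tested
  at a positive real point of the diagonal, and conversely a bound there dominates every point with
  smaller coordinates.\<close>

lemma convergent_series_iff:
  assumes f: "f \<in> carrier (series_algebra n)"
  shows "convergent_series n f \<longleftrightarrow> (\<exists>r B. geometrically_bounded n f r B)"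
proof
  let ?S = "{\<alpha>. Poly_Mapping.keys \<alpha> \<subseteq> {..<n}}"
  let ?t = "\<lambda>z \<alpha>. f \<alpha> * (\<Prod>i<n. z i ^ Poly_Mapping.lookup \<alpha> i)"
  {
    assume "convergent_series n f"
    then obtain \<rho> where \<rho>: "\<rho> > 0" "\<And>z. (\<And>i. i < n \<Longrightarrow> norm (z i) < \<rho>) \<Longrightarrow> ?t z summable_on ?S"
      unfolding convergent_series_def by blast
    \<comment> \<open>The polydisc is open, so the test point needs a radius strictly below
      \<open>\<rho>\<close>.\<close>
    define r where "r = \<rho> / 2"
    have "r > 0" using \<rho>(1) by (simp add: r_def)
    have "norm (complex_of_real r) < \<rho>" using \<rho>(1) by (simp add: r_def)
    then have "?t (\<lambda>_. complex_of_real r) summable_on ?S" by (intro \<rho>(2))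
    then have "(\<lambda>\<alpha>. norm (?t (\<lambda>_. complex_of_real r) \<alpha>)) summable_on ?S"
      by (simp only: summable_on_iff_abs_summable_on_complex)
    moreover have "norm (?t (\<lambda>_. complex_of_real r) \<alpha>) = norm (f \<alpha>) * r ^ total_degree n \<alpha>" for \<alpha>
      using \<open>r > 0\<close> by (simp add: norm_mult norm_power total_degree_def power_sum flip: prod_norm)
    ultimately have sm: "(\<lambda>\<alpha>. norm (f \<alpha>) * r ^ total_degree n \<alpha>) summable_on ?S" by simp
    have "(\<Sum>\<alpha>\<in>Y. norm (f \<alpha>) * r ^ total_degree n \<alpha>) \<le>
        (\<Sum>\<^sub>\<infinity>\<alpha>\<in>?S. norm (f \<alpha>) * r ^ total_degree n \<alpha>)" if "finite Y" for Y
    proof -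
      \<comment> \<open>Exponents that involve other variables contribute nothing, since
        \<open>f\<close> vanishes on them.\<close>
      have "(\<Sum>\<alpha>\<in>Y. norm (f \<alpha>) * r ^ total_degree n \<alpha>) = (\<Sum>\<alpha>\<in>Y \<inter> ?S. norm (f \<alpha>) * r ^ total_degree n \<alpha>)"
        by (rule sum.mono_neutral_right) (use that f in auto)
      also have "\<dots> \<le> (\<Sum>\<^sub>\<infinity>\<alpha>\<in>?S. norm (f \<alpha>) * r ^ total_degree n \<alpha>)"
        by (rule finite_sum_le_infsum) (use sm that \<open>r > 0\<close> in auto)
      finally show ?thesis .
    qed
    then show "\<exists>r B. geometrically_bounded n f r B"
      using \<open>r > 0\<close> unfolding geometrically_bounded_def by blast
  }
  {
    assume "\<exists>r B. geometrically_bounded n f r B"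
    then obtain r B where r: "r > 0"
        and B: "\<And>Y. finite Y \<Longrightarrow> (\<Sum>\<alpha>\<in>Y. norm (f \<alpha>) * r ^ total_degree n \<alpha>) \<le> B"
      unfolding geometrically_bounded_def by blast
    have "?t z summable_on ?S" if z: "\<And>i. i < n \<Longrightarrow> norm (z i) < r" for z
      unfolding summable_on_iff_abs_summable_on_complex
    proof (rule nonneg_bdd_above_summable_on)
      have le: "norm (?t z \<alpha>) \<le> norm (f \<alpha>) * r ^ total_degree n \<alpha>" for \<alpha>
      proof -
        have "(\<Prod>i<n. norm (z i) ^ Poly_Mapping.lookup \<alpha> i) \<le> (\<Prod>i<n. r ^ Poly_Mapping.lookup \<alpha> i)"
          using z by (intro prod_mono conjI power_mono) (auto intro: less_imp_le)
        then show ?thesis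
          by (simp add: norm_mult norm_power total_degree_def power_sum mult_left_mono flip: prod_norm)
      qed
      show "bdd_above (sum (\<lambda>\<alpha>. norm (?t z \<alpha>)) ` {Y. Y \<subseteq> ?S \<and> finite Y})"
      proof (rule bdd_aboveI2)
        fix Y :: "(nat \<Rightarrow>\<^sub>0 nat) set" assume "Y \<in> {Y. Y \<subseteq> ?S \<and> finite Y}"
        then have "finite Y" by simp
        have "sum (\<lambda>\<alpha>. norm (?t z \<alpha>)) Y \<le> (\<Sum>\<alpha>\<in>Y. norm (f \<alpha>) * r ^ total_degree n \<alpha>)"
          by (rule sum_mono) (rule le)
        also have "\<dots> \<le> B" using B[OF \<open>finite Y\<close>] .
        finally show "sum (\<lambda>\<alpha>. norm (?t z \<alpha>)) Y \<le> B" .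
      qed
    qed simp
    then show "convergent_series n f" using r unfolding convergent_series_def by blast
  }
qed

lemma geometrically_bounded_mono:
  assumes f: "geometrically_bounded n f r B" and s: "0 < s" "s \<le> r" and g: "\<And>\<alpha>. norm (g \<alpha>) \<le> norm (f \<alpha>)"
  shows "geometrically_bounded n g s B"
  unfolding geometrically_bounded_def
proof (intro conjI allI impI s)
  fix Y :: "(nat \<Rightarrow>\<^sub>0 nat) set" assume "finite Y"
  then have "(\<Sum>\<alpha>\<in>Y. norm (f \<alpha>) * r ^ total_degree n \<alpha>) \<le> B"
    using f unfolding geometrically_bounded_def by blast
  moreover have "(\<Sum>\<alpha>\<in>Y. norm (g \<alpha>) * s ^ total_degree n \<alpha>) \<le> (\<Sum>\<alpha>\<in>Y. norm (f \<alpha>) * r ^ total_degree n \<alpha>)"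
    by (intro sum_mono mult_mono power_mono g) (use s in auto)
  ultimately show "(\<Sum>\<alpha>\<in>Y. norm (g \<alpha>) * s ^ total_degree n \<alpha>) \<le> B" by linarith
qed

lemma geometrically_bounded_add:
  assumes f: "geometrically_bounded n f r B" and g: "geometrically_bounded n g r B'"
  shows "geometrically_bounded n (\<lambda>\<alpha>. f \<alpha> + g \<alpha>) r (B + B')"
  unfolding geometrically_bounded_def
proof (intro conjI allI impI)
  show r: "0 < r" using f unfolding geometrically_bounded_def by blast
  fix Y :: "(nat \<Rightarrow>\<^sub>0 nat) set" assume "finite Y"
  then have "(\<Sum>\<alpha>\<in>Y. norm (f \<alpha>) * r ^ total_degree n \<alpha>) \<le> B" "(\<Sum>\<alpha>\<in>Y. norm (g \<alpha>) * r ^ total_degree n \<alpha>) \<le> B'"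
    using f g unfolding geometrically_bounded_def by blast+
  moreover have "(\<Sum>\<alpha>\<in>Y. norm (f \<alpha> + g \<alpha>) * r ^ total_degree n \<alpha>) \<le>
      (\<Sum>\<alpha>\<in>Y. norm (f \<alpha>) * r ^ total_degree n \<alpha> + norm (g \<alpha>) * r ^ total_degree n \<alpha>)"
    unfolding distrib_right[symmetric]
    by (intro sum_mono mult_right_mono norm_triangle_ineq) (use r in simp)
  ultimately show "(\<Sum>\<alpha>\<in>Y. norm (f \<alpha> + g \<alpha>) * r ^ total_degree n \<alpha>) \<le> B + B'"
    unfolding sum.distrib by linarith
qed

lemma geometrically_bounded_smult:
  assumes f: "geometrically_bounded n f r B"
  shows "geometrically_bounded n (\<lambda>\<alpha>. c * f \<alpha>) r (norm c * B)"
  unfolding geometrically_bounded_def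
proof (intro conjI allI impI)
  show r: "0 < r" using f unfolding geometrically_bounded_def by blast
  fix Y :: "(nat \<Rightarrow>\<^sub>0 nat) set" assume "finite Y"
  then have "(\<Sum>\<alpha>\<in>Y. norm (f \<alpha>) * r ^ total_degree n \<alpha>) \<le> B"
    using f unfolding geometrically_bounded_def by blast
  then show "(\<Sum>\<alpha>\<in>Y. norm (c * f \<alpha>) * r ^ total_degree n \<alpha>) \<le> norm c * B"
    by (simp add: norm_mult mult.assoc mult_left_mono flip: sum_distrib_left)
qed

text \<open>Adding \<open>eps i\<close> is injective and raises the total degree by one, which
  accounts for the factor \<open>1/r\<close>.\<close>

lemma geometrically_bounded_shift:
  assumes f: "geometrically_bounded n f r B" and i: "i < n"
  shows "geometrically_bounded n (\<lambda>\<alpha>. f (\<alpha> + eps i)) r (B / r)"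
  unfolding geometrically_bounded_def
proof (intro conjI allI impI)
  show r: "0 < r" using f unfolding geometrically_bounded_def by blast
  fix Y :: "(nat \<Rightarrow>\<^sub>0 nat) set" assume "finite Y"
  then have "(\<Sum>\<alpha>\<in>(\<lambda>\<alpha>. \<alpha> + eps i) ` Y. norm (f \<alpha>) * r ^ total_degree n \<alpha>) \<le> B"
    using f unfolding geometrically_bounded_def by blast
  also have "(\<Sum>\<alpha>\<in>(\<lambda>\<alpha>. \<alpha> + eps i) ` Y. norm (f \<alpha>) * r ^ total_degree n \<alpha>) =
      r * (\<Sum>\<alpha>\<in>Y. norm (f (\<alpha> + eps i)) * r ^ total_degree n \<alpha>)"
    using i by (subst sum.reindex[OF inj_on_subset[OF inj_add_eps subset_UNIV]])
      (simp add: total_degree_add total_degree_eps sum_distrib_left mult.left_commute)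
  finally show "(\<Sum>\<alpha>\<in>Y. norm (f (\<alpha> + eps i)) * r ^ total_degree n \<alpha>) \<le> B / r"
    using r by (simp add: pos_le_divide_eq mult.commute)
qed

text \<open>Halving the radius gains a factor \<open>2\<close> to the power of the total degree, and
  this absorbs the factor that differentiation brings in. What remains is the bound for the shifted
  series.\<close>

lemma geometrically_bounded_deriv:
  assumes f: "geometrically_bounded n f r B" and i: "i < n"
  shows "geometrically_bounded n (series_deriv i f) (r / 2) (B / r)"
  unfolding geometrically_bounded_def
proof (intro conjI allI impI)
  have r: "0 < r" using f unfolding geometrically_bounded_def by blast
  then show "0 < r / 2" by simp
  fix Y :: "(nat \<Rightarrow>\<^sub>0 nat) set" assume "finite Y"
  then have "(\<Sum>\<alpha>\<in>Y. norm (f (\<alpha> + eps i)) * r ^ total_degree n \<alpha>) \<le> B / r"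
    using geometrically_bounded_shift[OF f i] unfolding geometrically_bounded_def by blast
  moreover have "(\<Sum>\<alpha>\<in>Y. norm (series_deriv i f \<alpha>) * (r / 2) ^ total_degree n \<alpha>) \<le>
      (\<Sum>\<alpha>\<in>Y. norm (f (\<alpha> + eps i)) * r ^ total_degree n \<alpha>)"
  proof (rule sum_mono)
    fix \<alpha>
    have "Poly_Mapping.lookup \<alpha> i \<le> total_degree n \<alpha>"
      unfolding total_degree_def using i by (intro member_le_sum) auto
    then have "Suc (Poly_Mapping.lookup \<alpha> i) \<le> 2 ^ total_degree n \<alpha>"
      using less_exp[of "total_degree n \<alpha>"] by linarith
    then have "real (Suc (Poly_Mapping.lookup \<alpha> i)) \<le> 2 ^ total_degree n \<alpha>"
      by (metis of_nat_le_iff of_nat_numeral of_nat_power)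
    then have "real (Suc (Poly_Mapping.lookup \<alpha> i)) * (r / 2) ^ total_degree n \<alpha> \<le> r ^ total_degree n \<alpha>"
      using r by (simp add: power_divide field_simps del: of_nat_Suc)
    then have "norm (f (\<alpha> + eps i)) * (real (Suc (Poly_Mapping.lookup \<alpha> i)) * (r / 2) ^ total_degree n \<alpha>)
        \<le> norm (f (\<alpha> + eps i)) * r ^ total_degree n \<alpha>"
      by (rule mult_left_mono) simp
    then show "norm (series_deriv i f \<alpha>) * (r / 2) ^ total_degree n \<alpha> \<le>
        norm (f (\<alpha> + eps i)) * r ^ total_degree n \<alpha>"
      by (simp add: series_deriv_def norm_mult ac_simps del: of_nat_Suc)
  qed
  ultimately show "(\<Sum>\<alpha>\<in>Y. norm (series_deriv i f \<alpha>) * (r / 2) ^ total_degree n \<alpha>) \<le> B / r"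
    by linarith
qed

text \<open>The weighted \<open>l1\<close> norm is submultiplicative because total degree is
  additive. The antidiagonals over \<open>Y\<close> are disjoint; their union \<open>Z\<close> lies
  in the rectangle formed by its two projections, where the sum factors.\<close>

lemma geometrically_bounded_mult:
  assumes f: "geometrically_bounded n f r B" and g: "geometrically_bounded n g r B'"
  shows "geometrically_bounded n (cauchy_prod f g) r (B * B')"
  unfolding geometrically_bounded_def
proof (intro conjI allI impI)
  show r: "0 < r" using f unfolding geometrically_bounded_def by blast
  let ?A = "\<lambda>\<gamma>. {(\<alpha>, \<beta>). \<alpha> + \<beta> = (\<gamma> :: nat \<Rightarrow>\<^sub>0 nat)}"
  let ?F = "\<lambda>\<alpha>. norm (f \<alpha>) * r ^ total_degree n \<alpha>" and ?G = "\<lambda>\<alpha>. norm (g \<alpha>) * r ^ total_degree n \<alpha>"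
  fix Y :: "(nat \<Rightarrow>\<^sub>0 nat) set" assume Y: "finite Y"
  define Z where "Z = (\<Union>\<gamma>\<in>Y. ?A \<gamma>)"
  have Z: "finite Z" unfolding Z_def using Y finite_antidiagonal by blast
  have F: "sum ?F (fst ` Z) \<le> B" and G: "sum ?G (snd ` Z) \<le> B'"
    using f g Z unfolding geometrically_bounded_def by blast+
  have "(\<Sum>\<gamma>\<in>Y. norm (cauchy_prod f g \<gamma>) * r ^ total_degree n \<gamma>) \<le> (\<Sum>\<gamma>\<in>Y. \<Sum>p\<in>?A \<gamma>. ?F (fst p) * ?G (snd p))"
  proof (rule sum_mono)
    fix \<gamma>
    have "norm (cauchy_prod f g \<gamma>) * r ^ total_degree n \<gamma> \<le> (\<Sum>p\<in>?A \<gamma>. norm (f (fst p) * g (snd p))) * r ^ total_degree n \<gamma>"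
      unfolding cauchy_prod_def case_prod_beta
      by (intro mult_right_mono norm_sum) (use r in simp)
    also have "\<dots> = (\<Sum>p\<in>?A \<gamma>. ?F (fst p) * ?G (snd p))"
      unfolding sum_distrib_right
      by (rule sum.cong) (auto simp: norm_mult total_degree_add power_add)
    finally show "norm (cauchy_prod f g \<gamma>) * r ^ total_degree n \<gamma> \<le> (\<Sum>p\<in>?A \<gamma>. ?F (fst p) * ?G (snd p))" .
  qed
  also have "\<dots> = (\<Sum>p\<in>Z. ?F (fst p) * ?G (snd p))"
    unfolding Z_def by (rule sum.UNION_disjoint[symmetric]) (use Y finite_antidiagonal in auto)
  also have "\<dots> \<le> (\<Sum>p\<in>fst ` Z \<times> snd ` Z. ?F (fst p) * ?G (snd p))"
    by (rule sum_mono2) (use Z r in \<open>auto intro: rev_image_eqI\<close>)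
  also have "\<dots> = sum ?F (fst ` Z) * sum ?G (snd ` Z)"
    by (simp add: sum_product sum.cartesian_product case_prod_beta)
  also have "\<dots> \<le> B * B'"
  proof (rule mult_mono[OF F G])
    have "0 \<le> sum ?F (fst ` Z)" by (rule sum_nonneg) (use r in simp)
    then show "0 \<le> B" using F by linarith
    show "0 \<le> sum ?G (snd ` Z)" by (rule sum_nonneg) (use r in simp)
  qed
  finally show "(\<Sum>\<gamma>\<in>Y. norm (cauchy_prod f g \<gamma>) * r ^ total_degree n \<gamma>) \<le> B * B'" .
qed

lemma geometrically_bounded_monomial:
  "geometrically_bounded n (\<lambda>\<alpha>. if \<alpha> = \<beta> then 1 else 0) 1 1"
  unfolding geometrically_bounded_def
proof (intro conjI allI impI)
  fix Y :: "(nat \<Rightarrow>\<^sub>0 nat) set" assume "finite Y"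
  then have "(\<Sum>\<alpha>\<in>Y. norm (if \<alpha> = \<beta> then 1 else 0 :: complex) * 1 ^ total_degree n \<alpha>) =
      (\<Sum>\<alpha>\<in>Y \<inter> {\<beta>}. 1)"
    by (intro sum.mono_neutral_cong_right) auto
  also have "\<dots> \<le> 1" by (cases "\<beta> \<in> Y") auto
  finally show "(\<Sum>\<alpha>\<in>Y. norm (if \<alpha> = \<beta> then 1 else 0 :: complex) * 1 ^ total_degree n \<alpha>) \<le> 1" .
qed simp

lemma coeff_algebra_convergent_series:
  "coeff_algebra (convergent_series_algebra n) n (\<lambda>f. f)"
proof -
  interpret S: coeff_algebra "series_algebra n :: (complex, complex mseries) module" n "\<lambda>f. f"
    by (rule coeff_algebra_series)
  let ?S = "carrier (series_algebra n :: (complex, complex mseries) module)"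
  define C where "C = {f \<in> ?S. convergent_series n f}"
  have C: "f \<in> C \<longleftrightarrow> f \<in> ?S \<and> (\<exists>r B. geometrically_bounded n f r B)" for f
    unfolding C_def using convergent_series_iff by blast
  \<comment> \<open>Bounds persist at smaller radii, so two series are compared at the minimum of
    their radii.\<close>
  have common: "\<exists>r B B'. geometrically_bounded n f r B \<and> geometrically_bounded n g r B'"
    if fg: "f \<in> C" "g \<in> C" for f g
  proof -
    obtain r B s B' where *: "geometrically_bounded n f r B" "geometrically_bounded n g s B'"
      using fg unfolding C by blast
    then have "0 < min r s" unfolding geometrically_bounded_def by simp
    then have "geometrically_bounded n f (min r s) B" "geometrically_bounded n g (min r s) B'"
      using geometrically_bounded_mono[OF *(1)] geometrically_bounded_mono[OF *(2)] by simp_all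
    then show ?thesis by blast
  qed
  \<comment> \<open>The support conditions are inherited from the formal series; the bounds supply
    the convergence.\<close>
  note S_closed = S.a_closed S.m_closed S.smult_closed S.one_closed S.co_var S.co_deriv S.co_shift S.co_restrict
  note SC = S_closed[unfolded series_algebra_simps(2-6) image_ident]
  have "coeff_algebra ((series_algebra n)\<lparr>carrier := C\<rparr>) n (\<lambda>f. f)"
  proof (rule coeff_algebra_subalgebra)
    show "C \<subseteq> ?S" using C by blast
    show "(\<lambda>\<alpha>. if \<alpha> = 0 then 1 else 0) \<in> C"
      using SC(4) geometrically_bounded_monomial unfolding C by blast
    show "(\<lambda>\<alpha>. if \<alpha> = eps i then 1 else 0) \<in> C" if "i < n" for i
      using SC(5)[OF that] geometrically_bounded_monomial unfolding C by blast
    show "(\<lambda>\<alpha>. f \<alpha> + g \<alpha>) \<in> C" if "f \<in> C" "g \<in> C" for f g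
      using SC(1)[of f g] common[OF that] that geometrically_bounded_add unfolding C by blast
    show "cauchy_prod f g \<in> C" if "f \<in> C" "g \<in> C" for f g
      using SC(2)[of f g] common[OF that] that geometrically_bounded_mult unfolding C by blast
    show "(\<lambda>\<alpha>. c * f \<alpha>) \<in> C" if "f \<in> C" for c f
      using SC(3)[of f c] that geometrically_bounded_smult unfolding C by blast
    show "series_deriv i f \<in> C" if "i < n" "f \<in> C" for i f
      using SC(6)[OF that(1), of f] that geometrically_bounded_deriv unfolding C by blast
    show "(\<lambda>\<alpha>. f (\<alpha> + eps i)) \<in> C" if "i < n" "f \<in> C" for i f
      using SC(7)[OF that(1), of f] that geometrically_bounded_shift unfolding C by blast
    show "(\<lambda>\<alpha>. if Poly_Mapping.lookup \<alpha> i = 0 then f \<alpha> else 0) \<in> C" if i: "i < n" and f: "f \<in> C" for i f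
    proof -
      obtain r B where "geometrically_bounded n f r B" using f unfolding C by blast
      moreover from this have "0 < r" unfolding geometrically_bounded_def by blast
      ultimately have "geometrically_bounded n (\<lambda>\<alpha>. if Poly_Mapping.lookup \<alpha> i = 0 then f \<alpha> else 0) r B"
        by (rule geometrically_bounded_mono) auto
      then show ?thesis using SC(8)[OF i, of f] f unfolding C by blast
    qed
  qed
  then show ?thesis unfolding convergent_series_algebra_def C_def .
qed

text \<open>The three cases differ only in the coefficient map: \<open>Poly_Mapping.lookup\<close>
  for polynomials, the identity for both kinds of series.\<close>

theorem mainTheorem2:
  fixes n :: nat
    and E\<^sub>1 :: "('k::field_char_0 mpoly \<Rightarrow> 'k mpoly, 'e) module"
    and E\<^sub>2 :: "('k mseries \<Rightarrow> 'k mseries, 'e) module"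
    and E\<^sub>3 :: "(complex mseries \<Rightarrow> complex mseries, 'e) module"
  shows
    "(injective_module TYPE('k mpoly \<Rightarrow> 'k mpoly)
        (diff_op_ring (ring_of_type_algebra :: 'k ring) (poly_algebra n)) E\<^sub>1 \<longrightarrow>
      injective_module TYPE('m)
        (poly_algebra n :: ('k, 'k mpoly) module)
        (restrict_scalars (mult_op (poly_algebra n)) E\<^sub>1)) \<and>
     (injective_module TYPE('k mseries \<Rightarrow> 'k mseries)
        (diff_op_ring (ring_of_type_algebra :: 'k ring) (series_algebra n)) E\<^sub>2 \<longrightarrow>
      injective_module TYPE('m)
        (series_algebra n :: ('k, 'k mseries) module)
        (restrict_scalars (mult_op (series_algebra n)) E\<^sub>2)) \<and>
     (injective_module TYPE(complex mseries \<Rightarrow> complex mseries)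
        (diff_op_ring (ring_of_type_algebra :: complex ring) (convergent_series_algebra n)) E\<^sub>3 \<longrightarrow>
      injective_module TYPE('m)
        (convergent_series_algebra n)
        (restrict_scalars (mult_op (convergent_series_algebra n)) E\<^sub>3))"
  using coeff_algebra.injective_restrict_scalars[OF coeff_algebra_poly]
    coeff_algebra.injective_restrict_scalars[OF coeff_algebra_series]
    coeff_algebra.injective_restrict_scalars[OF coeff_algebra_convergent_series]
  by blast

end
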